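(* Let $C$ be a relative of the Hermitian curve over $\mathbb{F}_q$. Suppose that $C$ has at least two rational inflexions. Then $C$ is projectively equivalent to the curve \[ C_\omega:\quad x^{\sqrt{q}}y + \omega x y^{\sqrt{q}} + z^{\sqrt{q}+1} = 0 \] for some $\omega \in \mathbb{F}_q^{\ast}$. Conversely, for every $\omega\in\mathbb{F}_q^{\ast}$ the curve $C_\omega$ has at least two rational inflexions. Moreover: (a) If $\omega = 1$, then $C_\omega$ has $(\sqrt{q})^3+1$ rational points, all of them are inflexions, and $C_\omega$ is Hermitian. Therefore a Hermitian-relative curve with $(\sqrt{q})^3+1$ rational inflexions is unique up to projective equivalence. (b) If $\mathrm{Nm}\,\omega = 1$ and $\omega \neq 1$, then $C_\omega$ has $\sqrt{q}+1$ rational points, and all of them are inflexions. In this case, $C_\omega$ is projectively equivalent to the curve \[ D_\eta:\quad x^{\sqrt{q}+1} + y^{\sqrt{q}+1} + \eta z^{\sqrt{q}+1} = 0 \] for a certain $\eta \in \mathbb{F}_q^{\ast}\setminus \mathbb{F}_{\sqrt{q}}^{\ast}$. Conversely, every curve $D_\eta$ with $\eta \in \mathbb{F}_q^{\ast}\setminus \mathbb{F}_{\sqrt{q}}^{\ast}$ is projectively equivalent to $C_\omega$ for a certain $\omega$ with $\mathrm{Nm}\,\omega=1$ and $\omega\neq 1$. For $\eta,\eta' \in \mathbb{F}_q^{\ast}\setminus \mathbb{F}_{\sqrt{q}}^{\ast}$, the curves $D_\eta$ and $D_{\eta'}$ are projectively equivalent to each other if and only if $\eta\eta'^{-1}\in\mathbb{F}_{\sqrt{q}}^{\ast}$.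 Therefore there are, up to projective equivalence, exactly $\sqrt{q}$ Hermitian-relative curves having $\sqrt{q}+1$ rational points all of which are inflexions. (c) If $\mathrm{Nm}\,\omega \neq 1$, then $C_\omega$ has $q+1$ rational points, and exactly two of them are inflexions. For $\omega,\omega' \in \mathbb{F}_q^{\ast}\setminus \mathrm{Ker}(\mathrm{Nm})$, the curves $C_\omega$ and $C_{\omega'}$ are projectively equivalent if and only if $\omega'=\omega$ or $\omega'=\omega^{-\sqrt{q}}$. Therefore there are, up to projective equivalence, exactly $\frac{1}{2}(\sqrt{q}+1)(\sqrt{q}-2)$ Hermitian-relative curves with exactly two rational inflexions.
   Context: Throughout, $q$ is an even power of a prime number $p$, so $\sqrt{q}$ is also a power of $p$. For $A \in GL(3,\mathbb{F}_q)$, $C_A \subset \mathbb{P}^2$ denotes the (nonsingular) plane curve over $\mathbb{F}_q$ of degree $\sqrt{q}+1$ defined by $(x^{\sqrt{q}}, y^{\sqrt{q}}, z^{\sqrt{q}})\, A\, {}^t(x,y,z)=0$; it depends only on the image of $A$ in $PGL(3,\mathbb{F}_q)$. A relative of the Hermitian curve (Hermitian-relative curve) is a curve of the form $C_A$ with $A\in GL(3,\mathbb{F}_q)$. Let $A^{\ast}$ denote the transpose of the matrix obtained from $A$ by raising every entry to the $\sqrt{q}$-th power. A curve is Hermitian if it equals $C_A$ for some $A\in GL(3,\mathbb{F}_q)$ with $A=A^{\ast}$. The tangent line at a point of $C_A$ meets $C_A$ at that point with multiplicity $\sqrt{q}$ or $\sqrt{q}+1$; the point is called an inflexion if the multiplicity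 is $\sqrt{q}+1$. "Rational point" means $\mathbb{F}_q$-point, and a rational inflexion is an inflexion that is an $\mathbb{F}_q$-point; in this statement, inflexions among the rational points are counted. "Projectively equivalent" means projectively equivalent over $\mathbb{F}_q$, i.e. by an element of $PGL(3,\mathbb{F}_q)$. $\mathrm{Nm}:\mathbb{F}_q^{\ast}\to\mathbb{F}_{\sqrt{q}}^{\ast}$ is the norm map $\alpha\mapsto\alpha^{\sqrt{q}+1}$. The superscript $\ast$ on a field denotes its multiplicative group of nonzero elements. *)

theory Defs
  imports
    "HOL-Analysis.Analysis"
    "HOL-Computational_Algebra.Polynomial"
    "HOL-Library.Poly_Mapping"
    "HOL-Library.Extended_Nat"
begin

text \<open>
  Polynomials in three variables, indexed by the type \<open>3\<close> (the variables \<open>x, y, z\<close> are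
  \<open>Var 1, Var 2, Var 3\<close>), as finitely supported maps from exponent vectors to coefficients;
  the ring structure is the one of \<open>Poly_Mapping\<close>.
\<close>

type_synonym 'a ternary = "(3 \<Rightarrow>\<^sub>0 nat) \<Rightarrow>\<^sub>0 'a"

definition Const :: "'a::comm_ring_1 \<Rightarrow> 'a ternary" where
  "Const c = Poly_Mapping.single 0 c"

definition Var :: "3 \<Rightarrow> 'a::comm_ring_1 ternary" where
  "Var i = Poly_Mapping.single (Poly_Mapping.single i 1) 1"

text \<open>
  Substitution of ring elements \<open>v i\<close> for the variables, the coefficients being mapped into the
  target ring by \<open>h\<close>.
\<close>

definition subst_poly ::
    "('a::comm_ring_1 \<Rightarrow> 'b::comm_ring_1) \<Rightarrow> (3 \<Rightarrow> 'b) \<Rightarrow> 'a ternary \<Rightarrow> 'b" where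
  "subst_poly h v F =
     (\<Sum>m\<in>Poly_Mapping.keys F.
        h (Poly_Mapping.lookup F m) * (\<Prod>i\<in>UNIV. v i ^ Poly_Mapping.lookup m i))"

definition eval_at :: "'a::comm_ring_1 ternary \<Rightarrow> 'a ^ 3 \<Rightarrow> 'a" where
  "eval_at F v = subst_poly (\<lambda>c. c) (\<lambda>i. v $ i) F"

definition linear_change :: "'a::comm_ring_1 ^ 3 ^ 3 \<Rightarrow> 'a ternary \<Rightarrow> 'a ternary" where
  "linear_change T F = subst_poly Const (\<lambda>i. \<Sum>j\<in>UNIV. Const (T $ i $ j) * Var j) F"

definition partial_deriv :: "3 \<Rightarrow> 'a::comm_ring_1 ternary \<Rightarrow> 'a ternary" where
  "partial_deriv i F =
     (\<Sum>m\<in>Poly_Mapping.keys F.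
        Poly_Mapping.single (m - Poly_Mapping.single i 1)
          (of_nat (Poly_Mapping.lookup m i) * Poly_Mapping.lookup F m))"

text \<open>
  A plane curve is given by a defining form; two forms define the same curve iff they
  agree up to a nonzero constant.
\<close>

definition same_curve :: "'a::field ternary \<Rightarrow> 'a ternary \<Rightarrow> bool" where
  "same_curve F G \<longleftrightarrow> (\<exists>c. c \<noteq> 0 \<and> G = Const c * F)"

definition proj_equiv :: "'a::field ternary \<Rightarrow> 'a ternary \<Rightarrow> bool" where
  "proj_equiv F G \<longleftrightarrow> (\<exists>T. invertible T \<and> same_curve (linear_change T F) G)"

text \<open>
  A set of forms is counted as a set of curves up to projective equivalence. Passing from forms to
  curves loses nothing here, since forms of the same curve are projectively equivalent.
\<close>

definition num_up_to_proj_equiv :: "'a::field ternary set \<Rightarrow> nat" where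
  "num_up_to_proj_equiv S = card (S // {(F, G). proj_equiv F G})"

text \<open>Points of the projective plane over \<open>'a\<close> are the lines through the origin of \<open>'a ^ 3\<close>.\<close>

definition rational_points :: "'a::field ternary \<Rightarrow> ('a ^ 3) set set" where
  "rational_points F = {vec.span {v} | v. v \<noteq> 0 \<and> eval_at F v = 0}"

definition tangent_line :: "'a::field ternary \<Rightarrow> 'a ^ 3 \<Rightarrow> ('a ^ 3) set" where
  "tangent_line F v = {w. (\<Sum>i\<in>UNIV. eval_at (partial_deriv i F) v * w $ i) = 0}"

text \<open>
  Multiplicity at \<open>[v]\<close> of the intersection of \<open>F = 0\<close> with the line joining \<open>[v]\<close> and \<open>[w]\<close>:
  the order of vanishing of \<open>F (v + t w)\<close> at \<open>t = 0\<close>.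
\<close>

definition line_mult :: "'a::field ternary \<Rightarrow> 'a ^ 3 \<Rightarrow> 'a ^ 3 \<Rightarrow> enat" where
  "line_mult F v w =
     (let f = subst_poly (\<lambda>c. [:c:]) (\<lambda>i. [:v $ i, w $ i:]) F
      in if f = 0 then \<infinity> else enat (order 0 f))"

text \<open>
  Throughout, \<open>s\<close> is the square root of the order of the field. The condition
  \<open>tangent_line F v = vec.span {v, w}\<close> says that \<open>[v]\<close> is a nonsingular point whose tangent line is
  the line joining \<open>[v]\<close> and \<open>[w]\<close>: the left-hand side has dimension at least 2, and
  dimension 3 if all partial derivatives vanish at \<open>v\<close>.
\<close>

definition rational_inflexions :: "nat \<Rightarrow> 'a::field ternary \<Rightarrow> ('a ^ 3) set set" where
  "rational_inflexions s F =
     {vec.span {v} | v. v \<noteq> 0 \<and> eval_at F v = 0 \<and>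
        (\<exists>w. tangent_line F v = vec.span {v, w} \<and> line_mult F v w = enat (s + 1))}"

definition herm_form :: "nat \<Rightarrow> 'a::field ^ 3 ^ 3 \<Rightarrow> 'a ternary" where
  "herm_form s A = (\<Sum>i\<in>UNIV. \<Sum>j\<in>UNIV. Var i ^ s * Const (A $ i $ j) * Var j)"

definition hermitian_relative :: "nat \<Rightarrow> 'a::field ternary \<Rightarrow> bool" where
  "hermitian_relative s F \<longleftrightarrow> (\<exists>A. invertible A \<and> same_curve F (herm_form s A))"

definition star :: "nat \<Rightarrow> 'a::field ^ 3 ^ 3 \<Rightarrow> 'a ^ 3 ^ 3" where
  "star s A = transpose (\<chi> i j. (A $ i $ j) ^ s)"

definition hermitian :: "nat \<Rightarrow> 'a::field ternary \<Rightarrow> bool" where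
  "hermitian s F \<longleftrightarrow> (\<exists>A. invertible A \<and> A = star s A \<and> same_curve F (herm_form s A))"

definition is_subfield :: "'a::field set \<Rightarrow> bool" where
  "is_subfield K \<longleftrightarrow> 0 \<in> K \<and> 1 \<in> K \<and>
     (\<forall>a\<in>K. \<forall>b\<in>K. a - b \<in> K \<and> a * b \<in> K) \<and> (\<forall>a\<in>K. inverse a \<in> K)"

definition subfield_of_order :: "nat \<Rightarrow> 'a::field set" where
  "subfield_of_order s = (THE K. is_subfield K \<and> card K = s)"

definition Nm :: "nat \<Rightarrow> 'a::field \<Rightarrow> 'a" where
  "Nm s a = a ^ (s + 1)"

definition C_curve :: "nat \<Rightarrow> 'a::field \<Rightarrow> 'a ternary" where
  "C_curve s \<omega> = Var 1 ^ s * Var 2 + Const \<omega> * Var 1 * Var 2 ^ s + Var 3 ^ (s + 1)"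

definition D_curve :: "nat \<Rightarrow> 'a::field \<Rightarrow> 'a ternary" where
  "D_curve s \<eta> = Var 1 ^ (s + 1) + Var 2 ^ (s + 1) + Const \<eta> * Var 3 ^ (s + 1)"

end

theory Submission
  imports Defs
begin

text \<open>
  Write \<open>h (u, v) = \<Sum> u\<^sub>i\<^sup>s A\<^sub>i\<^sub>j v\<^sub>j\<close>. Since \<open>x \<mapsto> x\<^sup>s\<close> is an involution of a field with \<open>s\<^sup>2\<close> elements, \<open>h\<close> is a
  sesquilinear form, nondegenerate because \<open>A\<close> is invertible. The points of the curve of \<open>A\<close> are its isotropic lines, a change of
  coordinates \<open>T\<close> replaces \<open>A\<close> by \<open>T\<^sup>* A T\<close> (\<open>linear_change_herm_form\<close>), and a point \<open>v\<close> is an inflexion iff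
  the conditions \<open>h (v, w) = 0\<close> and \<open>h (w, v) = 0\<close> on \<open>w\<close> are equivalent (\<open>inflexion_iff\<close>).

  Given two inflexions \<open>v\<^sub>1\<close>, \<open>v\<^sub>2\<close>, let \<open>v\<^sub>3\<close> be orthogonal to both, that is, the intersection of their
  tangents. The symmetry of orthogonality at \<open>v\<^sub>1\<close> and \<open>v\<^sub>2\<close> makes \<open>h (v\<^sub>1, v\<^sub>2)\<close>, \<open>h (v\<^sub>2, v\<^sub>1)\<close> and \<open>h (v\<^sub>3, v\<^sub>3)\<close>
  the only nonzero entries of the Gram matrix, and rescaling leads to some \<open>C\<^sub>\<omega>\<close>
  (\<open>two_inflexions_equiv_C_curve\<close>). The same rescaling, applied to two points of \<open>D\<^sub>\<eta>\<close> on the line \<open>z = 0\<close>,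
  gives \<open>D\<^sub>\<eta> \<sim> C\<^sub>\<omega>\<close> with \<open>\<omega> = \<eta>\<^bsup>s - 1\<^esup>\<close> (\<open>D_curve_equiv_C_curve\<close>); by Hilbert's Theorem 90 every \<open>\<omega>\<close>
  of norm \<open>1\<close> has this form.

  To tell the \<open>C\<^sub>\<omega>\<close> apart, observe that \<open>(A\<^sup>*)\<^bsup>-1\<^esup> A\<close> is conjugated by \<open>T\<close> and multiplied by a scalar of
  norm \<open>1\<close> when \<open>A\<close> is replaced by \<open>c T\<^sup>* A T\<close>. For \<open>C\<^sub>\<omega>\<close> it is diagonal with eigenvalues \<open>\<omega>, \<omega>\<^bsup>-s\<^esup>, 1\<close>.
  Comparing eigenvalues, \<open>C\<^sub>\<omega> \<sim> C\<^sub>\<omega>\<^sub>'\<close> iff \<open>\<omega>' = \<omega>\<close> or \<open>\<omega>' = \<omega>\<^bsup>-s\<^esup>\<close> (\<open>C_curve_equiv_iff\<close>). The two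
  parameters coincide exactly when \<open>\<omega>\<close> has norm \<open>1\<close>.

  The points of \<open>C\<^sub>\<omega>\<close> other than \<open>(0 : 1 : 0)\<close> correspond to the solutions of \<open>y + \<omega> y\<^sup>s = - z\<^bsup>s + 1\<^esup>\<close>, and the
  three cases of the theorem reflect the behaviour of the additive map on the left: it is the trace for
  \<open>\<omega> = 1\<close>; for other \<open>\<omega>\<close> of norm \<open>1\<close> the only value it shares with the right-hand side is \<open>0\<close>; otherwise it is bijective. The
  numbers of equivalence classes then come from counting the \<open>\<omega>\<close> of each kind.
\<close>

section \<open>Powers and the Frobenius map in a field of square order\<close>

text \<open>
  Multiplication by \<open>x\<close> permutes \<open>M\<close>, so the product over \<open>M\<close> absorbs the factor \<open>x ^ card M\<close>. Used for the
  units of the field and for the units of a subfield.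
\<close>

lemma power_card_eq_1:
  fixes M :: "'a::field set"
  assumes "finite M" "0 \<notin> M" "\<And>x y. x \<in> M \<Longrightarrow> y \<in> M \<Longrightarrow> x * y \<in> M" "x \<in> M"
  shows "x ^ card M = 1"
proof -
  have inj: "inj_on ((*) x) M" using assms by (auto simp: inj_on_def)
  have "(*) x ` M = M"
    using assms inj by (intro card_subset_eq) (auto simp: card_image)
  hence "(\<Prod>y\<in>M. y) = (\<Prod>y\<in>M. x * y)"
    using prod.reindex[OF inj, of "\<lambda>y. y"] by simp
  also have "\<dots> = x ^ card M * (\<Prod>y\<in>M. y)" by (simp add: prod.distrib)
  finally show ?thesis using assms by (simp add: prod_zero_iff)
qed

lemma card_power_fibre_le:
  fixes c :: "'a::field"
  assumes "n > 0"
  shows "card {x. x ^ n = c} \<le> n"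
proof -
  let ?P = "Polynomial.monom 1 n + [:- c:] :: 'a poly"
  have d: "degree ?P = n" using assms
    by (subst degree_add_eq_left) (simp_all add: degree_monom_eq)
  have "?P \<noteq> 0" using d assms by force
  from card_poly_roots_bound[OF this] show ?thesis
    unfolding d by (simp add: poly_monom)
qed

text \<open>
  If at most \<open>e\<close> fibres with at most \<open>d\<close> elements each cover \<open>d e\<close> elements, there is no slack
  in either bound. Both surjectivity statements below, for power maps and for the trace, are counted this way.
\<close>

lemma card_fibre_eq:
  assumes "finite X" "finite U" "f ` X \<subseteq> U" "card U \<le> e" "card X = d * e"
    and le: "\<And>y. y \<in> U \<Longrightarrow> card {x \<in> X. f x = y} \<le> d"
    and y: "y \<in> U"
  shows "card {x \<in> X. f x = y} = d"
proof (rule ccontr)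
  assume "card {x \<in> X. f x = y} \<noteq> d"
  hence "card {x \<in> X. f x = y} < d" using le[OF y] by simp
  hence "(\<Sum>y\<in>U. card {x \<in> X. f x = y}) < (\<Sum>y\<in>U. d)"
    using le y \<open>finite U\<close> by (intro sum_strict_mono_ex1) auto
  also have "\<dots> \<le> d * e" using \<open>card U \<le> e\<close> by simp
  finally show False
    using sum.group[OF \<open>finite X\<close> \<open>finite U\<close> \<open>f ` X \<subseteq> U\<close>, of "\<lambda>_. 1 :: nat"] \<open>card X = d * e\<close>
    by simp
qed

text \<open>
  The fibres of \<open>x \<mapsto> x\<^sup>d\<close> over the \<open>e\<close>-th roots of unity have at most \<open>d\<close> elements, there are at
  most \<open>e\<close> of them, and together they exhaust the \<open>d e\<close> units; so both bounds are attained. This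
  gives the surjectivity of the norm (\<open>d = s + 1\<close>) and Hilbert's Theorem 90 (\<open>d = s - 1\<close>) at once.
\<close>

lemma card_power_fibre:
  fixes y :: "'a::{field,finite}"
  assumes "d * e = CARD('a) - 1" "y ^ e = 1"
  shows "card {x. x ^ d = y} = d"
proof -
  have c: "CARD('a) > 1" using card_mono[of UNIV "{0,1::'a}"] by simp
  have de: "d > 0" "e > 0" using assms c by (auto intro: Nat.gr0I)
  have "x ^ card (- {0::'a}) = 1" if "x \<noteq> 0" for x :: 'a
    by (rule power_card_eq_1) (use that in auto)
  hence x1: "(x ^ d) ^ e = 1" if "x \<noteq> 0" for x :: 'a
    using that by (simp add: assms Compl_eq_Diff_UNIV flip: power_mult)
  have eq: "{x \<in> - {0}. x ^ d = z} = {x. x ^ d = z}" if "z ^ e = 1" for z :: 'a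
    using that de by (auto simp: power_0_left)
  have "card {x \<in> - {0}. x ^ d = y} = d"
  proof (rule card_fibre_eq[where U = "{y. y ^ e = 1}" and e = e])
    show "card {y::'a. y ^ e = 1} \<le> e" by (rule card_power_fibre_le) fact
    show "card (- {0::'a}) = d * e" using assms(1) by (simp add: Compl_eq_Diff_UNIV)
    show "card {x \<in> - {0}. x ^ d = z} \<le> d" if "z \<in> {y. y ^ e = 1}" for z :: 'a
      using that eq card_power_fibre_le[OF de(1), of z] by simp
  qed (use x1 assms(2) in auto)
  thus ?thesis using eq[OF assms(2)] by simp
qed

text \<open>
  The numbers \<open>p\<close>, \<open>k\<close>, \<open>s\<close> do not determine the type of the field, which therefore enters through an
  argument of type \<open>itself\<close>.
\<close>

locale square_field =
  fixes p k s :: nat and ty :: "'a::{field,finite} itself"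
  assumes prime_p: "prime p" and k_pos: "k \<ge> 1" and s_def: "s = p ^ k"
    and card_field: "CARD('a) = s ^ 2"
begin

lemma s_ge_2: "s \<ge> 2"
proof -
  have "p ^ 1 \<le> p ^ k" using prime_p k_pos prime_ge_1_nat by (intro power_increasing) auto
  thus ?thesis using prime_ge_2_nat[OF prime_p] s_def by simp
qed

lemma s_pos [simp]: "s > 0"
  using s_ge_2 by simp

lemma CHAR_eq: "CHAR('a) = p"
proof -
  \<comment> \<open>Translating the sum of all elements by \<open>1\<close> shows that the order of the field annihilates \<open>1\<close>.\<close>
  have "(\<Sum>x\<in>UNIV. x) = (\<Sum>x\<in>UNIV. x + 1 :: 'a)"
    by (rule sum.reindex_bij_witness[of _ "\<lambda>x. x + 1" "\<lambda>x. x - 1"]) auto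
  hence "of_nat (CARD('a)) = (0::'a)" by (simp add: sum.distrib)
  hence "CHAR('a) dvd p ^ (k * 2)"
    by (simp add: of_nat_eq_0_iff_char_dvd card_field s_def power_mult del: of_nat_power)
  moreover have "prime CHAR('a)"
    by (rule prime_CHAR_semidom) (simp add: finite_imp_CHAR_pos)
  ultimately show ?thesis
    using prime_p by (meson prime_dvd_power primes_dvd_imp_eq)
qed

lemma CHAR_ternary: "CHAR('a ternary) = p"
proof (rule CHAR_eqI)
  have *: "of_nat n = (0 :: 'a ternary) \<longleftrightarrow> of_nat n = (0::'a)" for n
    unfolding single_of_nat[symmetric]
    by (metis lookup_single_eq single_zero)
  show "of_nat p = (0 :: 'a ternary)" unfolding * using CHAR_eq of_nat_CHAR by metis
  show "p dvd n" if "of_nat n = (0 :: 'a ternary)" for n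
    using that unfolding * by (simp add: of_nat_eq_0_iff_char_dvd CHAR_eq)
qed

lemma frob_add: "(x + y :: 'a) ^ s = x ^ s + y ^ s"
  by (rule freshmans_dream') (use prime_p s_def in \<open>simp_all add: CHAR_eq\<close>)

lemma frob_sum: "(sum f X :: 'a) ^ s = (\<Sum>i\<in>X. f i ^ s)"
  by (rule freshmans_dream_sum') (use prime_p s_def in \<open>simp_all add: CHAR_eq\<close>)

lemma frob_add_poly: "(x + y :: 'a poly) ^ s = x ^ s + y ^ s"
  by (rule freshmans_dream') (use prime_p s_def in \<open>simp_all add: CHAR_eq\<close>)

lemma frob_sum_ternary: "(sum f X :: 'a ternary) ^ s = (\<Sum>i\<in>X. f i ^ s)"
  by (rule freshmans_dream_sum') (use prime_p s_def in \<open>simp_all add: CHAR_ternary\<close>)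

lemma frob_uminus: "(- x :: 'a) ^ s = - (x ^ s)"
  using frob_add[of x "- x"] s_ge_2 by (simp add: power_0_left eq_neg_iff_add_eq_0 add.commute)

lemma frob_diff: "(x - y :: 'a) ^ s = x ^ s - y ^ s"
  using frob_add[of x "- y"] by (simp add: frob_uminus)

lemma minus_1_s: "(- 1 :: 'a) ^ s = - 1"
  by (simp add: frob_uminus)

lemma frob_frob [simp]: "((x::'a) ^ s) ^ s = x"
proof (cases "x = 0")
  case False
  have "x ^ card (- {0::'a}) = 1"
    by (rule power_card_eq_1) (use False in auto)
  moreover have "s * s = Suc (card (- {0::'a}))"
    using s_ge_2 by (simp add: Compl_eq_Diff_UNIV card_field power2_eq_square Suc_diff_1 del: mult_Suc)
  ultimately show ?thesis by (simp flip: power_mult)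
qed (use s_ge_2 in \<open>simp add: power_0_left\<close>)

lemma frob_eq_iff [simp]: "(x::'a) ^ s = y ^ s \<longleftrightarrow> x = y"
  by (metis frob_frob)

lemma power_s_eq_0 [simp]: "(x::'a) ^ s = 0 \<longleftrightarrow> x = 0"
  using s_ge_2 by auto

lemma zero_power_s [simp]: "(0::'a) ^ s = 0"
  by simp

lemma card_units: "(s + 1) * (s - 1) = CARD('a) - 1" "(s - 1) * (s + 1) = CARD('a) - 1"
  using s_ge_2 by (simp_all add: card_field power2_eq_square algebra_simps)

lemma card_Nm_fibre:
  assumes "(y::'a) ^ s = y" "y \<noteq> 0"
  shows "card {x. x ^ (s + 1) = y} = s + 1"
proof (rule card_power_fibre[OF card_units(1)])
  have "y * y ^ (s - 1) = y ^ s" using s_ge_2 by (simp flip: power_Suc)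
  thus "y ^ (s - 1) = 1" using assms by (metis mult_cancel_left1)
qed

lemma card_Hilbert90_fibre:
  assumes "(y::'a) ^ (s + 1) = 1"
  shows "card {x. x ^ (s - 1) = y} = s - 1"
  by (rule card_power_fibre[OF card_units(2) assms])

lemma power_s_eq_mult: "(x::'a) ^ s = x ^ (s - 1) * x"
  using s_ge_2 by (simp flip: power_Suc2)

lemma unit_power_Nm:
  assumes "(x::'a) \<noteq> 0"
  shows "(x ^ (s - 1)) ^ (s + 1) = 1"
proof -
  have "x = (x ^ s) ^ s" by simp
  also have "\<dots> = (x ^ (s - 1)) ^ (s + 1) * x"
    by (simp add: power_s_eq_mult[of x] power_mult_distrib mult_ac)
  finally show ?thesis using assms by simp
qed

text \<open>
  Apart from \<open>0\<close>, the fixed points of the Frobenius map form the fibre over \<open>1\<close> of \<open>x \<mapsto> x\<^bsup>s - 1\<^esup>\<close>.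
\<close>

lemma card_fixed_field: "card {x::'a. x ^ s = x} = s"
proof -
  have "{x::'a. x ^ s = x} = insert 0 {x. x ^ (s - 1) = 1}"
    using s_ge_2 by (auto simp: power_s_eq_mult)
  moreover have "(0::'a) \<notin> {x. x ^ (s - 1) = 1}" using s_ge_2 by (auto simp: power_0_left)
  ultimately show ?thesis using card_Hilbert90_fibre[of 1] s_ge_2 by simp
qed

text \<open>
  A subfield with \<open>s\<close> elements has \<open>s - 1\<close> units, so its elements are fixed by \<open>x \<mapsto> x\<^sup>s\<close>; there are only \<open>s\<close>
  fixed points, hence it contains all of them.
\<close>

lemma subfield_eq_fixed: "subfield_of_order s = {x::'a. x ^ s = x}"
  unfolding subfield_of_order_def
proof (rule the_equality)
  show "is_subfield {x::'a. x ^ s = x} \<and> card {x::'a. x ^ s = x} = s"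
    by (simp add: is_subfield_def card_fixed_field frob_diff power_mult_distrib power_inverse)
next
  fix K :: "'a set"
  assume K: "is_subfield K \<and> card K = s"
  have "x ^ s = x" if x: "x \<in> K" for x
  proof (cases "x = 0")
    case False
    have "x ^ card (K - {0}) = 1"
      by (rule power_card_eq_1) (use K False x in \<open>auto simp: is_subfield_def\<close>)
    moreover have "card (K - {0}) = s - 1" using K by (simp add: is_subfield_def)
    ultimately show ?thesis by (simp add: power_s_eq_mult)
  qed simp
  thus "K = {x. x ^ s = x}"
    using K card_fixed_field by (intro card_subset_eq) auto
qed

end

section \<open>Forms as matrices\<close>

text \<open>
  Over a field with \<open>s\<^sup>2\<close> elements this is a form that is linear in \<open>v\<close> and conjugate-linear in \<open>u\<close>, with Gram
  matrix \<open>A\<close>. The points of the curve of \<open>A\<close> are the isotropic lines.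
\<close>

definition sesq :: "nat \<Rightarrow> 'a::comm_ring_1 ^ 'n ^ 'n \<Rightarrow> 'a ^ 'n \<Rightarrow> 'a ^ 'n \<Rightarrow> 'a" where
  "sesq s A u v = (\<Sum>i\<in>UNIV. \<Sum>j\<in>UNIV. u $ i ^ s * A $ i $ j * v $ j)"

text \<open>
  The exponent vector of \<open>x\<^sub>i\<^sup>s x\<^sub>j\<close>.
\<close>

definition bimonom :: "nat \<Rightarrow> 3 \<Rightarrow> 3 \<Rightarrow> (3 \<Rightarrow>\<^sub>0 nat)" where
  "bimonom s i j = Poly_Mapping.single i s + Poly_Mapping.single j 1"

lemma Var_power: "Var i ^ n = Poly_Mapping.single (Poly_Mapping.single i n) 1"
  by (induction n) (simp_all add: Var_def mult_single flip: single_add)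

lemma herm_form_monomials:
  "herm_form s A = (\<Sum>i\<in>UNIV. \<Sum>j\<in>UNIV. Poly_Mapping.single (bimonom s i j) (A $ i $ j))"
  unfolding herm_form_def Var_power
  by (simp add: Var_def Const_def mult_single bimonom_def)

text \<open>
  Evaluation, substitution and differentiation are all given by sums of the following kind, so
  on a form of degree \<open>s + 1\<close> they can be computed monomial by monomial.
\<close>

lemma keys_sum_add:
  fixes f :: "'k \<Rightarrow> 'a::ab_group_add \<Rightarrow> 'b::ab_group_add"
  assumes "\<And>m. f m 0 = 0" "\<And>m a b. f m (a + b) = f m a + f m b"
  shows "(\<Sum>m\<in>Poly_Mapping.keys (F + G). f m (Poly_Mapping.lookup (F + G) m)) =
    (\<Sum>m\<in>Poly_Mapping.keys F. f m (Poly_Mapping.lookup F m)) +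
    (\<Sum>m\<in>Poly_Mapping.keys G. f m (Poly_Mapping.lookup G m))"
proof -
  let ?U = "Poly_Mapping.keys F \<union> Poly_Mapping.keys G"
  have eq: "(\<Sum>m\<in>Poly_Mapping.keys H. f m (Poly_Mapping.lookup H m)) =
      (\<Sum>m\<in>?U. f m (Poly_Mapping.lookup H m))" if "Poly_Mapping.keys H \<subseteq> ?U" for H
    by (intro sum.mono_neutral_left that) (auto simp: assms in_keys_iff)
  show ?thesis
    unfolding eq[OF Poly_Mapping.keys_add] eq[OF Un_upper1] eq[OF Un_upper2]
    by (simp add: lookup_add assms sum.distrib)
qed

lemma keys_sum_sum:
  fixes f :: "'k \<Rightarrow> 'a::ab_group_add \<Rightarrow> 'b::ab_group_add"
  assumes "\<And>m. f m 0 = 0" "\<And>m a b. f m (a + b) = f m a + f m b" "finite I"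
  shows "(\<Sum>m\<in>Poly_Mapping.keys (\<Sum>i\<in>I. F i). f m (Poly_Mapping.lookup (\<Sum>i\<in>I. F i) m)) =
    (\<Sum>i\<in>I. \<Sum>m\<in>Poly_Mapping.keys (F i). f m (Poly_Mapping.lookup (F i) m))"
  using assms(3)
  by induction (simp_all add: keys_sum_add[of f, OF assms(1,2)])

lemma keys_sum_single:
  assumes "\<And>m. f m 0 = 0"
  shows "(\<Sum>m\<in>Poly_Mapping.keys (Poly_Mapping.single k c).
    f m (Poly_Mapping.lookup (Poly_Mapping.single k c) m)) = f k c"
  by (cases "c = 0") (simp_all add: assms)

lemma keys_sum_herm_form:
  fixes f :: "(3 \<Rightarrow>\<^sub>0 nat) \<Rightarrow> 'a::field \<Rightarrow> 'b::ab_group_add"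
  assumes "\<And>m. f m 0 = 0" "\<And>m a b. f m (a + b) = f m a + f m b"
  shows "(\<Sum>m\<in>Poly_Mapping.keys (herm_form s A). f m (Poly_Mapping.lookup (herm_form s A) m)) =
    (\<Sum>i\<in>UNIV. \<Sum>j\<in>UNIV. f (bimonom s i j) (A $ i $ j))"
  unfolding herm_form_monomials
  by (simp add: keys_sum_sum[of f, OF assms] keys_sum_single[of f, OF assms(1)]
      del: keys_single)

lemma prod_power_single:
  fixes v :: "'k::finite \<Rightarrow> 'b::comm_ring_1"
  shows "(\<Prod>l\<in>UNIV. v l ^ Poly_Mapping.lookup (Poly_Mapping.single i n) l) = v i ^ n"
proof -
  have "v l ^ Poly_Mapping.lookup (Poly_Mapping.single i n) l = (if i = l then v l ^ n else 1)" for l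
    by (simp add: lookup_single when_def)
  thus ?thesis by simp
qed

lemma prod_power_bimonom:
  "(\<Prod>l\<in>UNIV. v l ^ Poly_Mapping.lookup (bimonom s i j) l) = (v i ^ s * v j :: 'b::comm_ring_1)"
  using prod_power_single[of v j 1]
  by (simp add: bimonom_def lookup_add power_add prod.distrib prod_power_single)

lemma subst_poly_herm_form:
  assumes "h 0 = 0" "\<And>a b. h (a + b) = h a + h b"
  shows "subst_poly h v (herm_form s A) =
    (\<Sum>i\<in>UNIV. \<Sum>j\<in>UNIV. h (A $ i $ j) * (v i ^ s * v j))"
  unfolding subst_poly_def
  by (subst keys_sum_herm_form) (simp_all add: assms prod_power_bimonom algebra_simps)

lemma eval_at_herm_form: "eval_at (herm_form s A) v = sesq s A v v"
  unfolding eval_at_def sesq_def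
  by (subst subst_poly_herm_form) (simp_all add: mult_ac)

lemma eval_at_sum:
  assumes "finite I"
  shows "eval_at (\<Sum>i\<in>I. F i) v = (\<Sum>i\<in>I. eval_at (F i) v)"
  unfolding eval_at_def subst_poly_def
  by (rule keys_sum_sum[where f = "\<lambda>m c. c * (\<Prod>i\<in>UNIV. v $ i ^ Poly_Mapping.lookup m i)", OF _ _ assms])
    (simp_all add: algebra_simps)

lemma eval_at_single:
  "eval_at (Poly_Mapping.single m c) v = c * (\<Prod>i\<in>UNIV. v $ i ^ Poly_Mapping.lookup m i)"
  unfolding eval_at_def subst_poly_def
  by (rule keys_sum_single[where f = "\<lambda>m c. c * (\<Prod>i\<in>UNIV. v $ i ^ Poly_Mapping.lookup m i)"]) simp

text \<open>
  In characteristic dividing \<open>s\<close> the factor \<open>x\<^sub>i\<^sup>s\<close> of each monomial is a constant for the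
  derivations, so the gradient at \<open>v\<close> is the row vector \<open>v\<^sup>s A\<close>.
\<close>

lemma eval_at_partial_deriv_herm_form:
  assumes "of_nat s = (0::'a::field)"
  shows "eval_at (partial_deriv l (herm_form s A)) v = (\<Sum>i\<in>UNIV. v $ i ^ s * A $ i $ l :: 'a)"
proof -
  have eq: "eval_at (Poly_Mapping.single (bimonom s i j - Poly_Mapping.single l 1)
      (of_nat (Poly_Mapping.lookup (bimonom s i j) l) * A $ i $ j)) v =
      (if l = j then v $ i ^ s * A $ i $ j else 0)" for i j
  proof (cases "l = j")
    case True
    hence "bimonom s i j - Poly_Mapping.single l 1 = Poly_Mapping.single i s"
      by (simp add: bimonom_def)
    moreover have "of_nat (Poly_Mapping.lookup (bimonom s i j) l) = (1 :: 'a)"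
      using True assms by (simp add: bimonom_def lookup_add lookup_single when_def)
    ultimately show ?thesis using True by (simp add: eval_at_single prod_power_single)
  next
    case False
    thus ?thesis using assms
      by (simp add: eval_at_single bimonom_def lookup_add lookup_single when_def)
  qed
  show ?thesis
    unfolding partial_deriv_def
    by (subst keys_sum_herm_form) (simp_all add: distrib_left single_add eval_at_sum eq del: One_nat_def)
qed

text \<open>
  For \<open>s = 1\<close> the monomials \<open>x\<^sub>i x\<^sub>j\<close> and \<open>x\<^sub>j x\<^sub>i\<close> would coincide; from \<open>s = 2\<close> on, \<open>i\<close> is the only index with
  exponent at least \<open>s\<close>. So a form determines its matrix.
\<close>

lemma bimonom_inject:
  assumes "s \<ge> 2"
  shows "bimonom s i j = bimonom s i' j' \<longleftrightarrow> i = i' \<and> j = j'"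
proof
  assume eq: "bimonom s i j = bimonom s i' j'"
  hence "Poly_Mapping.lookup (bimonom s i j) i = Poly_Mapping.lookup (bimonom s i' j') i" by simp
  hence "i = i'" using assms
    by (auto simp: bimonom_def lookup_add lookup_single when_def split: if_splits)
  moreover from this eq have "Poly_Mapping.single j (1::nat) = Poly_Mapping.single j' 1"
    by (simp add: bimonom_def)
  hence "Poly_Mapping.lookup (Poly_Mapping.single j (1::nat)) j =
    Poly_Mapping.lookup (Poly_Mapping.single j' 1) j" by simp
  hence "j = j'" by (simp add: lookup_single when_def split: if_splits)
  ultimately show "i = i' \<and> j = j'" by simp
qed simp

lemma herm_form_inject:
  assumes "s \<ge> 2"
  shows "herm_form s A = herm_form s B \<longleftrightarrow> A = B"
proof
  have *: "Poly_Mapping.lookup (herm_form s A) (bimonom s i j) = A $ i $ j" for A :: "'a ^ 3 ^ 3" and i j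
  proof -
    have "Poly_Mapping.lookup (herm_form s A) (bimonom s i j) =
      (\<Sum>i'\<in>UNIV. \<Sum>j'\<in>UNIV. if j' = j then (if i' = i then A $ i' $ j' else 0) else 0)"
      unfolding herm_form_monomials lookup_sum
      by (intro sum.cong refl) (auto simp: lookup_single when_def bimonom_inject[OF assms])
    thus ?thesis by simp
  qed
  assume "herm_form s A = herm_form s B"
  thus "A = B" unfolding vec_eq_iff using * by metis
qed simp

definition scale_mat :: "'a::comm_ring_1 \<Rightarrow> 'a ^ 'n ^ 'm \<Rightarrow> 'a ^ 'n ^ 'm" where
  "scale_mat c A = (\<chi> i j. c * A $ i $ j)"

lemma Const_mult_herm_form: "Const c * herm_form s A = herm_form s (scale_mat c A)"
  unfolding herm_form_monomials
  by (simp add: Const_def sum_distrib_left mult_single scale_mat_def)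

lemma scale_mat_scale_mat [simp]: "scale_mat a (scale_mat b A) = scale_mat (a * b) A"
  by (simp add: scale_mat_def vec_eq_iff mult_ac)

lemma scale_mat_1 [simp]: "scale_mat 1 A = A"
  by (simp add: scale_mat_def vec_eq_iff)

lemma scale_mat_mult_left: "scale_mat c A ** B = scale_mat c (A ** B)"
  by (simp add: scale_mat_def matrix_matrix_mult_def vec_eq_iff sum_distrib_left mult_ac)

lemma scale_mat_mult_right: "A ** scale_mat c B = scale_mat c (A ** B)"
  by (simp add: scale_mat_def matrix_matrix_mult_def vec_eq_iff sum_distrib_left mult_ac)

lemma invertible_scale_mat:
  fixes A :: "'a::field ^ 'n ^ 'n"
  assumes "invertible A" "c \<noteq> 0"
  shows "invertible (scale_mat c A)"
proof -
  obtain B where B: "A ** B = mat 1" using assms(1) invertible_right_inverse by blast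
  hence "scale_mat c A ** scale_mat (inverse c) B = mat 1"
    using assms(2) by (simp add: scale_mat_mult_left scale_mat_mult_right)
  thus ?thesis using invertible_right_inverse by blast
qed

lemma hermitian_relative_iff: "hermitian_relative s F \<longleftrightarrow> (\<exists>A. invertible A \<and> F = herm_form s A)"
proof
  assume "hermitian_relative s F"
  then obtain A c where A: "invertible A" "c \<noteq> 0" "herm_form s A = Const c * F"
    unfolding hermitian_relative_def same_curve_def by blast
  have "F = Const (inverse c) * (Const c * F)"
    using A(2) by (simp add: Const_def mult_single flip: mult.assoc)
  also have "\<dots> = herm_form s (scale_mat (inverse c) A)"
    by (simp add: A(3)[symmetric] Const_mult_herm_form)
  finally show "\<exists>A. invertible A \<and> F = herm_form s A"
    using invertible_scale_mat[OF A(1), of "inverse c"] A(2) by auto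
next
  assume "\<exists>A. invertible A \<and> F = herm_form s A"
  thus "hermitian_relative s F"
    unfolding hermitian_relative_def same_curve_def
    by (metis mult_1 one_neq_zero Const_def single_one)
qed

lemma same_curve_herm_form:
  "same_curve (herm_form s A) G \<longleftrightarrow> (\<exists>c. c \<noteq> 0 \<and> G = herm_form s (scale_mat c A))"
  by (simp add: same_curve_def Const_mult_herm_form)

context square_field
begin

lemma of_nat_s: "of_nat s = (0::'a)"
  using k_pos by (simp add: of_nat_eq_0_iff_char_dvd CHAR_eq s_def dvd_power)

text \<open>
  The Frobenius map is additive on polynomials, so the \<open>s\<close>-th power of a linear form involves only
  \<open>s\<close>-th powers of the variables: a linear change of variables acts on matrices as a congruence.
\<close>

lemma linear_change_herm_form:
  "linear_change T (herm_form s A) = herm_form s (star s T ** A ** (T :: 'a ^ 3 ^ 3))"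
proof -
  have Const_mult: "Const (a * b) = Const a * Const (b::'a)" for a b
    by (simp add: Const_def mult_single)
  have Const_add: "Const (a + b) = Const a + Const (b::'a)" for a b
    by (simp add: Const_def single_add)
  have Const_power: "Const (a::'a) ^ n = Const (a ^ n)" for a n
    by (induction n) (simp_all add: Const_mult, simp add: Const_def)
  let ?L = "\<lambda>i. \<Sum>l\<in>UNIV. Const (T $ i $ l) * Var l :: 'a ternary"
  have "linear_change T (herm_form s A) =
      (\<Sum>i\<in>UNIV. \<Sum>j\<in>UNIV. Const (A $ i $ j) * (?L i ^ s * ?L j))"
    unfolding linear_change_def
    by (rule subst_poly_herm_form) (simp_all add: Const_def single_add)
  also have "\<dots> = herm_form s (star s T ** A ** T)"
    unfolding herm_form_def frob_sum_ternary power_mult_distrib Const_power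
    by (simp add: star_def matrix_matrix_mult_def transpose_def sum_3 Const_mult Const_add
        algebra_simps)
  finally show ?thesis .
qed

lemma proj_equiv_herm_form:
  "proj_equiv (herm_form s A) G \<longleftrightarrow>
    (\<exists>T c. invertible (T :: 'a ^ 3 ^ 3) \<and> c \<noteq> 0 \<and> G = herm_form s (scale_mat c (star s T ** A ** T)))"
  unfolding proj_equiv_def linear_change_herm_form same_curve_herm_form by blast

text \<open>
  Expanding \<open>F (v + t w)\<close> with \<open>(v + t w)\<^sup>s = v\<^sup>s + t\<^sup>s w\<^sup>s\<close> leaves only the powers \<open>1, t, t\<^sup>s, t\<^bsup>s + 1\<^esup>\<close>, whose
  coefficients are the four values of the form on \<open>v\<close> and \<open>w\<close>.
\<close>

lemma line_polynomial:
  "subst_poly (\<lambda>c. [:c:]) (\<lambda>i. [:v $ i, w $ i:]) (herm_form s A) =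
    [:sesq s A v v, sesq s A v w:] + Polynomial.monom 1 s * [:sesq s A w v, sesq s A w (w :: 'a ^ 3):]"
proof -
  have sum_pCons: "(\<Sum>i\<in>UNIV. [:f i, g i:]) = [:\<Sum>i\<in>UNIV. f i, \<Sum>i\<in>UNIV. g i:]" for f g :: "3 \<Rightarrow> 'a"
    by (simp add: sum_3)
  have pow: "[:a, b:] ^ s = [:a ^ s:] + Polynomial.monom 1 s * [:b ^ s:]" for a b :: 'a
  proof -
    have "[:a, b:] ^ s = ([:a:] + Polynomial.monom b 1) ^ s" by (simp add: monom_altdef)
    also have "\<dots> = [:a:] ^ s + Polynomial.monom b 1 ^ s" by (rule frob_add_poly)
    finally show ?thesis by (simp add: poly_const_pow monom_power smult_monom)
  qed
  have const_mult: "[:a ^ s * b * c, a ^ s * b * d:] = [:a ^ s:] * [:b:] * [:c, d:]" for a b c d :: 'a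
    by simp
  have "subst_poly (\<lambda>c. [:c:]) (\<lambda>i. [:v $ i, w $ i:]) (herm_form s A) =
    (\<Sum>i\<in>UNIV. \<Sum>j\<in>UNIV. [:A $ i $ j:] * ([:v $ i, w $ i:] ^ s * [:v $ j, w $ j:]))"
    by (rule subst_poly_herm_form) simp_all
  also have "\<dots> = (\<Sum>i\<in>UNIV. \<Sum>j\<in>UNIV.
      [:v $ i ^ s * A $ i $ j * v $ j, v $ i ^ s * A $ i $ j * w $ j:] +
      Polynomial.monom 1 s * [:w $ i ^ s * A $ i $ j * v $ j, w $ i ^ s * A $ i $ j * w $ j:])"
    unfolding pow const_mult by (simp only: ring_distribs mult_ac)
  finally show ?thesis
    unfolding sesq_def by (simp only: sum.distrib sum_pCons sum_distrib_left[symmetric])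
qed

lemma line_mult_herm_form:
  assumes "sesq s A v v = 0" "sesq s A v w = 0"
  shows "line_mult (herm_form s A) v (w :: 'a ^ 3) = enat (s + 1) \<longleftrightarrow>
    sesq s A w v = 0 \<and> sesq s A w w \<noteq> 0"
proof -
  let ?q = "[:sesq s A w v, sesq s A w w:]"
  let ?f = "Polynomial.monom 1 s * ?q"
  have f: "subst_poly (\<lambda>c. [:c:]) (\<lambda>i. [:v $ i, w $ i:]) (herm_form s A) = ?f"
    by (simp add: line_polynomial assms)
  show ?thesis
  proof (cases "?q = 0")
    case False
    hence "?f \<noteq> 0" unfolding mult_eq_0_iff by simp
    moreover have "order 0 ?f = s + order 0 ?q"
      using order_mult[OF \<open>?f \<noteq> 0\<close>, of 0] by (simp add: order_0_monom)
    moreover have "order 0 ?q = 1 \<longleftrightarrow> sesq s A w v = 0 \<and> sesq s A w w \<noteq> 0"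
    proof (cases "sesq s A w v = 0")
      case True
      hence "?q = Polynomial.monom (sesq s A w w) 1" by (simp add: monom_altdef)
      thus ?thesis using True False by (simp add: order_0_monom)
    next
      case False
      thus ?thesis by (simp add: order_0I)
    qed
    ultimately show ?thesis unfolding line_mult_def f by (simp add: Let_def)
  next
    case True
    thus ?thesis unfolding line_mult_def f by (auto simp: Let_def)
  qed
qed

end

section \<open>Inflexions of the curve of a matrix\<close>

subsection \<open>Linear functionals on a three-dimensional space\<close>

lemma span_singleton_iff: "x \<in> vec.span {v} \<longleftrightarrow> (\<exists>k. x = k *s v)"
  by (auto simp: vec.span_singleton)

lemma span_singleton_scale: "k \<noteq> 0 \<Longrightarrow> vec.span {k *s v} = vec.span {v :: 'a::field ^ 'n}"
proof -
  assume "k \<noteq> 0"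
  hence "v = inverse k *s (k *s v)" by simp
  thus ?thesis unfolding vec.span_eq
    by (metis empty_subsetI insert_subset span_singleton_iff)
qed

lemma span_pairD:
  assumes "x \<in> vec.span {v, w}"
  shows "\<exists>a b. x = a *s v + b *s w"
proof -
  obtain a b where "x - a *s v = b *s w"
    using assms by (auto simp: vec.span_breakdown_eq[of x v] span_singleton_iff)
  hence "x = a *s v + b *s w" by (simp add: diff_eq_eq add.commute)
  thus ?thesis by blast
qed

lemma sum_mult_axis: "(\<Sum>i\<in>UNIV. f $ i * axis m a $ i) = f $ m * (a :: 'a::comm_ring_1)"
  by (simp add: axis_def if_distrib cong: if_cong)

lemma kernel_subset_proportional:
  fixes r r' :: "'a::field ^ 'n"
  assumes "r \<noteq> 0"
    and sub: "\<And>w. (\<Sum>i\<in>UNIV. r $ i * w $ i) = 0 \<Longrightarrow> (\<Sum>i\<in>UNIV. r' $ i * w $ i) = 0"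
  shows "\<exists>c. \<forall>w. (\<Sum>i\<in>UNIV. r' $ i * w $ i) = c * (\<Sum>i\<in>UNIV. r $ i * w $ i)"
proof -
  obtain m where m: "r $ m \<noteq> 0" using assms(1) by (auto simp: vec_eq_iff)
  let ?u = "axis m (inverse (r $ m))"
  \<comment> \<open>As \<open>r \<cdot> ?u = 1\<close>, subtracting \<open>(r \<cdot> w) ?u\<close> from \<open>w\<close> gives a vector in the kernel of \<open>r\<close>.\<close>
  have "(\<Sum>i\<in>UNIV. r' $ i * w $ i) = (r' $ m * inverse (r $ m)) * (\<Sum>i\<in>UNIV. r $ i * w $ i)" for w
  proof -
    let ?t = "\<Sum>i\<in>UNIV. r $ i * w $ i"
    have lin: "(\<Sum>i\<in>UNIV. f $ i * (w - ?t *s ?u) $ i) =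
        (\<Sum>i\<in>UNIV. f $ i * w $ i) - ?t * (f $ m * inverse (r $ m))" for f :: "'a ^ 'n"
      using sum_mult_axis[of f m "inverse (r $ m)"]
      by (simp add: right_diff_distrib sum_subtractf mult.left_commute[of _ ?t] flip: sum_distrib_left)
    have "(\<Sum>i\<in>UNIV. r $ i * (w - ?t *s ?u) $ i) = 0"
      unfolding lin using m by simp
    from sub[OF this] show ?thesis unfolding lin by simp
  qed
  thus ?thesis by blast
qed

text \<open>
  The vectors \<open>r\<^sub>i e\<^sub>j - r\<^sub>j e\<^sub>i\<close> lie in the kernel; if they were all multiples of \<open>v\<close>, then \<open>r = 0\<close>. So the
  kernel contains some \<open>w\<close> outside the line of \<open>v\<close>, and by dimension it is spanned by \<open>v\<close> and \<open>w\<close>.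
\<close>

lemma kernel_eq_span:
  fixes r v :: "'a::field ^ 3"
  assumes r: "r \<noteq> 0" and v: "v \<noteq> 0" "(\<Sum>i\<in>UNIV. r $ i * v $ i) = 0"
  shows "\<exists>w. w \<notin> vec.span {v} \<and> {w. (\<Sum>i\<in>UNIV. r $ i * w $ i) = 0} = vec.span {v, w}"
proof -
  let ?K = "{w. (\<Sum>i\<in>UNIV. r $ i * w $ i) = 0}"
  have sub: "vec.subspace ?K"
    by (rule vec.subspaceI)
      (simp_all add: distrib_left sum.distrib mult.left_commute flip: sum_distrib_left)
  have "\<exists>w\<in>?K. w \<notin> vec.span {v}"
  proof (rule ccontr)
    assume "\<not> ?thesis"
    hence all: "\<exists>k. w = k *s v" if "w \<in> ?K" for w using that by (auto simp: span_singleton_iff)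
    have vanish: "r $ i = 0" if ijk: "distinct [i, j, l]" for i j l :: 3
    proof (rule ccontr)
      assume ri: "r $ i \<noteq> 0"
      define a where "a = axis j (r $ i) - axis i (r $ j)"
      define b where "b = axis l (r $ i) - axis i (r $ l)"
      have "a \<in> ?K" "b \<in> ?K"
        unfolding a_def b_def mem_Collect_eq vector_minus_component right_diff_distrib
          sum_subtractf sum_mult_axis by simp_all
      then obtain \<alpha> \<beta> where ab: "a = \<alpha> *s v" "b = \<beta> *s v" using all by blast
      have "a $ j = r $ i" "b $ j = 0" "b $ l = r $ i"
        using ijk by (auto simp: a_def b_def axis_def)
      thus False using ab ri by auto
    qed
    have "r = 0"
      using vanish[of 1 2 3] vanish[of 2 1 3] vanish[of 3 1 2] by (simp add: vec_eq_iff forall_3)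
    thus False using r by simp
  qed
  then obtain w where w: "w \<in> ?K" "w \<notin> vec.span {v}" by blast
  have neq: "w \<noteq> v" using w(2) vec.span_base[of v "{v}"] by auto
  have ind: "vec.independent {v, w}"
    using vec.independent_insertI[OF w(2)] v(1) by (simp add: insert_commute)
  have "?K \<noteq> UNIV"
  proof
    assume K: "?K = UNIV"
    have "r $ i = 0" for i
    proof -
      have "axis i 1 \<in> ?K" using K by simp
      thus ?thesis by (simp add: sum_mult_axis)
    qed
    thus False using r by (simp add: vec_eq_iff)
  qed
  hence "vec.dim ?K \<noteq> 3"
    using vec.dim_eq_full[of ?K] iffD2[OF vec.span_eq_iff sub]
    by (simp add: vec.dimension_def card_cart_basis)
  moreover have "vec.dim ?K \<le> 3"
    using vec.dim_subset_UNIV[of ?K] by (simp add: vec.dimension_def card_cart_basis)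
  ultimately have "vec.dim ?K \<le> card {v, w}" using neq by simp
  hence "?K \<subseteq> vec.span {v, w}"
    using v(2) w(1) ind by (intro vec.card_ge_dim_independent) auto
  moreover have "vec.span {v, w} \<subseteq> ?K"
    using v(2) w(1) sub by (intro vec.span_minimal) auto
  ultimately show ?thesis using w(2) by blast
qed

subsection \<open>The sesquilinear form of a matrix\<close>

lemma sesq_eq_functional:
  "sesq s A u v = (\<Sum>j\<in>UNIV. (\<chi> j. \<Sum>i\<in>UNIV. u $ i ^ s * A $ i $ j) $ j * v $ j)"
  unfolding sesq_def by (subst sum.swap) (simp add: sum_distrib_right)

lemma sesq_eq_mult: "sesq s A u v = (\<Sum>i\<in>UNIV. u $ i ^ s * (A *v v) $ i)"
  unfolding sesq_def by (simp add: matrix_vector_mult_def sum_distrib_left mult.assoc)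

lemma sesq_add_right: "sesq s A u (v + w) = sesq s A u v + sesq s A u w"
  by (simp add: sesq_def distrib_left sum.distrib)

lemma sesq_scale_right: "sesq s A u (c *s v) = c * sesq s A u v"
  by (simp add: sesq_def sum_distrib_left mult_ac)

lemma sesq_scale_left: "sesq s A (c *s u) v = c ^ s * sesq s A u v"
  by (simp add: sesq_def sum_distrib_left mult_ac power_mult_distrib)

lemma sesq_scale_mat: "sesq s (scale_mat c A) u v = c * sesq s A u v"
  by (simp add: sesq_def scale_mat_def sum_distrib_left mult_ac)

text \<open>
  The left and the right orthogonal complement of an isotropic vector agree. That this describes inflexions is the
  content of \<open>inflexion_iff\<close> below.
\<close>

definition inflexional :: "nat \<Rightarrow> 'a::comm_ring_1 ^ 'n ^ 'n \<Rightarrow> 'a ^ 'n \<Rightarrow> bool" where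
  "inflexional s A v \<longleftrightarrow> v \<noteq> 0 \<and> sesq s A v v = 0 \<and> (\<forall>w. sesq s A v w = 0 \<longleftrightarrow> sesq s A w v = 0)"

context square_field
begin

lemma sesq_add_left: "sesq s A (u + v) w = sesq s A u w + sesq s A v (w :: 'a ^ 'n)"
  by (simp add: sesq_def frob_add distrib_right sum.distrib)

lemma sesq_axis: "sesq s A (axis i 1) v = (A *v (v :: 'a ^ 'n)) $ i"
proof -
  have "(axis i 1 $ l) ^ s * x = (if l = i then x else 0)" for l and x :: 'a
    by (simp add: axis_def)
  thus ?thesis unfolding sesq_eq_mult by simp
qed

lemma sesq_axis_axis: "sesq s A (axis i 1) (axis j 1 :: 'a ^ 'n) = A $ i $ j"
  by (simp add: sesq_axis matrix_vector_mult_def sum_mult_axis)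

text \<open>
  Although \<open>sesq\<close> is only semilinear in its first argument, the \<open>s\<close>-th power of it is linear there,
  because \<open>x \<mapsto> x\<^sup>s\<close> is an involution of the field.
\<close>

lemma sesq_power_s: "sesq s A w v ^ s = (\<Sum>i\<in>UNIV. (\<chi> i. (A *v v) $ i ^ s) $ i * w $ i :: 'a)"
  unfolding sesq_eq_mult by (simp add: frob_sum power_mult_distrib mult.commute)

lemma sesq_nondegenerate_left:
  assumes "invertible A" "\<And>w. sesq s A u w = 0"
  shows "u = (0 :: 'a ^ 'n)"
proof -
  obtain B where B: "A ** B = mat 1" using assms(1) invertible_def by blast
  have "u $ i = 0" for i
  proof -
    have "A *v (B *v axis i 1) = axis i 1" by (simp add: matrix_vector_mul_assoc B)
    moreover have "sesq s A u (B *v axis i 1) = 0" by (rule assms)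
    ultimately have "(\<Sum>l\<in>UNIV. u $ l ^ s * axis i 1 $ l) = 0" by (simp add: sesq_eq_mult)
    thus ?thesis by (simp add: axis_def if_distrib cong: if_cong)
  qed
  thus ?thesis by (simp add: vec_eq_iff)
qed

lemma sesq_nondegenerate_right:
  assumes "invertible A" "\<And>w. sesq s A w v = 0"
  shows "v = (0 :: 'a ^ 'n)"
proof -
  have "A *v v = 0" using assms(2)[of "axis _ 1"] by (simp add: sesq_axis vec_eq_iff)
  thus ?thesis using assms(1)
    by (metis invertible_def matrix_vector_mul_assoc matrix_vector_mul_lid matrix_vector_mult_0_right)
qed

text \<open>
  A line on which the form vanishes identically would lie on the curve. On it all the functionals
  \<open>sesq s A u\<close> with \<open>u\<close> on the line would have the same kernel, hence be proportional, which
  nondegeneracy forbids.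
\<close>

lemma no_isotropic_line:
  fixes v w :: "'a ^ 3"
  assumes A: "invertible A" and vw: "v \<noteq> 0" "w \<notin> vec.span {v}"
    and iso: "sesq s A v v = 0" "sesq s A v w = 0" "sesq s A w v = 0" "sesq s A w w = 0"
  shows False
proof -
  let ?r = "\<lambda>u. (\<chi> j. \<Sum>i\<in>UNIV. u $ i ^ s * A $ i $ j)"
  have fn: "(\<Sum>j\<in>UNIV. ?r u $ j * x $ j) = sesq s A u x" for u x
    by (simp only: sesq_eq_functional)
  have r0: "?r v \<noteq> 0"
  proof
    assume "?r v = 0"
    hence "sesq s A v x = 0" for x unfolding fn[symmetric] by simp
    from sesq_nondegenerate_left[OF A this] vw(1) show False by simp
  qed
  obtain w' where w': "{x. (\<Sum>i\<in>UNIV. ?r v $ i * x $ i) = 0} = vec.span {v, w'}"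
    using kernel_eq_span[OF r0 vw(1)] iso(1) unfolding fn by blast
  have "w \<in> vec.span {v, w'}" using w' iso(2) unfolding fn by blast
  hence "w \<in> vec.span (insert w' {v})" by (simp add: insert_commute)
  hence "w' \<in> vec.span (insert w {v})" using vec.in_span_insert vw(2) by blast
  hence "vec.span {v, w'} \<subseteq> vec.span {v, w}"
    by (intro vec.span_minimal) (auto simp: insert_commute intro: vec.span_base)
  hence ker: "x \<in> vec.span {v, w}" if "sesq s A v x = 0" for x
    using w' that unfolding fn by blast
  have "sesq s A w x = 0" if x: "x \<in> vec.span {v, w}" for x
  proof -
    obtain a b where "x = a *s v + b *s w" using span_pairD[OF x] by blast
    thus ?thesis using iso by (simp add: sesq_add_right sesq_scale_right)
  qed
  hence "sesq s A w x = 0" if "sesq s A v x = 0" for x using ker that by blast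
  then obtain c where c: "sesq s A w x = c * sesq s A v x" for x
    using kernel_subset_proportional[OF r0, of "?r w"] unfolding fn by blast
  have "sesq s A (w + (- (c ^ s)) *s v) x = 0" for x
    by (simp only: sesq_add_left sesq_scale_left frob_uminus frob_frob c) simp
  from sesq_nondegenerate_left[OF A this] have "w = c ^ s *s v" by (simp add: vec_eq_iff add_eq_0_iff)
  thus False using vw(2) span_singleton_iff by blast
qed

subsection \<open>Inflexions\<close>

lemma tangent_line_herm_form: "tangent_line (herm_form s A) v = {w. sesq s A v w = (0 :: 'a)}"
  unfolding tangent_line_def eval_at_partial_deriv_herm_form[OF of_nat_s] sesq_eq_functional
  by simp

text \<open>
  For \<open>w\<close> on the tangent line at \<open>v\<close>, the equation of the curve takes at \<open>v + t w\<close> the value \<open>t\<^sup>s sesq s A w v + t\<^bsup>s + 1\<^esup> sesq s A w w\<close>.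
  So \<open>v\<close> is an inflexion iff \<open>sesq s A w v\<close> vanishes on the tangent line, which is the left orthogonal
  complement of \<open>v\<close>, that is, iff the two orthogonal complements of \<open>v\<close> agree. The coefficient of \<open>t\<^bsup>s + 1\<^esup>\<close> is
  then nonzero, because the form does not vanish identically on a line.
\<close>

lemma inflexion_iff:
  fixes v :: "'a ^ 3"
  assumes A: "invertible A" and v: "v \<noteq> 0" "sesq s A v v = 0"
  shows "(\<exists>w. tangent_line (herm_form s A) v = vec.span {v, w} \<and>
      line_mult (herm_form s A) v w = enat (s + 1)) \<longleftrightarrow>
    (\<forall>w. sesq s A v w = 0 \<longleftrightarrow> sesq s A w v = 0)"
proof -
  let ?r = "(\<chi> j. \<Sum>i\<in>UNIV. v $ i ^ s * A $ i $ j)"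
  have fn: "(\<Sum>j\<in>UNIV. ?r $ j * x $ j) = sesq s A v x" for x
    by (simp only: sesq_eq_functional)
  have r0: "?r \<noteq> 0"
  proof
    assume "?r = 0"
    hence "sesq s A v x = 0" for x unfolding fn[symmetric] by simp
    from sesq_nondegenerate_left[OF A this] v(1) show False by simp
  qed
  show ?thesis
  proof
    assume "\<exists>w. tangent_line (herm_form s A) v = vec.span {v, w} \<and>
      line_mult (herm_form s A) v w = enat (s + 1)"
    then obtain w where w: "{w. sesq s A v w = 0} = vec.span {v, w}"
      and mult: "line_mult (herm_form s A) v w = enat (s + 1)"
      unfolding tangent_line_herm_form by blast
    have "w \<in> vec.span {v, w}" by (rule vec.span_base) simp
    hence vw: "sesq s A v w = 0" using w by blast
    hence wv: "sesq s A w v = 0" using mult line_mult_herm_form[OF v(2) vw] by blast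
    have sub: "sesq s A x v = 0" if x: "sesq s A v x = 0" for x
    proof -
      have "x \<in> vec.span {v, w}" using w x by blast
      then obtain a b where "x = a *s v + b *s w" using span_pairD by blast
      thus ?thesis using v(2) wv by (simp add: sesq_add_left sesq_scale_left)
    qed
    \<comment> \<open>The kernel of \<open>sesq s A v\<close> is contained in that of the linear functional \<open>x \<mapsto> (sesq s A x v)\<^sup>s\<close>, so the
      two are proportional and the kernels agree.\<close>
    let ?r' = "\<chi> i. (A *v v) $ i ^ s"
    have "(\<Sum>i\<in>UNIV. ?r' $ i * x $ i) = 0" if "(\<Sum>i\<in>UNIV. ?r $ i * x $ i) = 0" for x
      unfolding sesq_power_s[symmetric] using sub[of x] that unfolding fn by simp
    then obtain c where "\<forall>x. (\<Sum>i\<in>UNIV. ?r' $ i * x $ i) = c * (\<Sum>i\<in>UNIV. ?r $ i * x $ i)"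
      using kernel_subset_proportional[OF r0] by blast
    hence c: "sesq s A x v ^ s = c * sesq s A v x" for x
      unfolding sesq_power_s[symmetric] fn by blast
    have "c \<noteq> 0"
    proof
      assume "c = 0"
      hence "sesq s A x v = 0" for x using c[of x] by simp
      from sesq_nondegenerate_right[OF A this] v(1) show False by simp
    qed
    thus "\<forall>w. sesq s A v w = 0 \<longleftrightarrow> sesq s A w v = 0"
      using c power_s_eq_0 by (metis mult_eq_0_iff)
  next
    assume eq: "\<forall>w. sesq s A v w = 0 \<longleftrightarrow> sesq s A w v = 0"
    obtain w where w: "w \<notin> vec.span {v}" "{w. sesq s A v w = 0} = vec.span {v, w}"
      using kernel_eq_span[OF r0 v(1)] v(2) unfolding fn by blast
    have "w \<in> vec.span {v, w}" by (rule vec.span_base) simp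
    hence vw: "sesq s A v w = 0" using w by blast
    hence wv: "sesq s A w v = 0" using eq by blast
    have "sesq s A w w \<noteq> 0" using no_isotropic_line[OF A v(1) w(1) v(2) vw wv] by blast
    thus "\<exists>w. tangent_line (herm_form s A) v = vec.span {v, w} \<and>
      line_mult (herm_form s A) v w = enat (s + 1)"
      using w(2) wv line_mult_herm_form[OF v(2) vw] unfolding tangent_line_herm_form by blast
  qed
qed

lemma rational_inflexions_herm_form:
  assumes "invertible A"
  shows "rational_inflexions s (herm_form s A) = {vec.span {v} | v :: 'a ^ 3. inflexional s A v}"
proof -
  have "v \<noteq> 0 \<and> sesq s A v v = 0 \<and> (\<exists>w. tangent_line (herm_form s A) v = vec.span {v, w} \<and>
      line_mult (herm_form s A) v w = enat (s + 1)) \<longleftrightarrow> inflexional s A v" for v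
    using inflexion_iff[OF assms, of v] unfolding inflexional_def by argo
  thus ?thesis unfolding rational_inflexions_def eval_at_herm_form by simp
qed

lemma rational_points_herm_form:
  "rational_points (herm_form s A) = {vec.span {v} | v :: 'a ^ 3. v \<noteq> 0 \<and> sesq s A v v = 0}"
  unfolding rational_points_def eval_at_herm_form ..

end

section \<open>Projective equivalence\<close>

context square_field
begin

lemma star_mult: "star s (T ** U) = star s U ** star s (T :: 'a ^ 3 ^ 3)"
  by (simp add: star_def transpose_def matrix_matrix_mult_def vec_eq_iff frob_sum
      power_mult_distrib mult.commute)

lemma star_star: "star s (star s T) = (T :: 'a ^ 3 ^ 3)"
  by (simp add: star_def transpose_def vec_eq_iff)

lemma star_mat_1: "star s (mat 1) = (mat 1 :: 'a ^ 3 ^ 3)"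
  by (auto simp: star_def transpose_def mat_def vec_eq_iff)

lemma star_scale_mat: "star s (scale_mat c T) = scale_mat (c ^ s) (star s (T :: 'a ^ 3 ^ 3))"
  by (simp add: star_def transpose_def scale_mat_def vec_eq_iff power_mult_distrib)

lemma invertible_star:
  assumes "invertible (T :: 'a ^ 3 ^ 3)"
  shows "invertible (star s T)"
proof -
  obtain B where "T ** B = mat 1" using assms invertible_def by blast
  hence "star s B ** star s T = mat 1" by (simp add: star_mat_1 flip: star_mult)
  thus ?thesis using invertible_left_inverse by blast
qed

lemma sesq_congruence:
  "sesq s (star s T ** A ** T) u v = sesq s A (T *v u) (T *v (v :: 'a ^ 3))"
proof -
  have "sesq s A (T *v u) (T *v v) =
      (\<Sum>i\<in>UNIV. (\<Sum>l\<in>UNIV. T $ i $ l ^ s * u $ l ^ s) * (A *v (T *v v)) $ i)"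
    by (simp add: sesq_eq_mult matrix_vector_mult_def frob_sum power_mult_distrib)
  also have "\<dots> = (\<Sum>l\<in>UNIV. u $ l ^ s * (star s T *v (A *v (T *v v))) $ l)"
    by (simp add: star_def transpose_def matrix_vector_mult_def[of "transpose _"] sum_distrib_left
        sum_distrib_right mult_ac matrix_vector_mult_def[of "\<chi> i j. _ i j"]) (rule sum.swap)
  finally show ?thesis by (simp add: sesq_eq_mult matrix_vector_mul_assoc matrix_mul_assoc)
qed

lemma congruence_entry:
  "(star s T ** A ** T) $ i $ j = sesq s A (column i T) (column j (T :: 'a ^ 3 ^ 3))"
  unfolding sesq_axis_axis[symmetric] sesq_congruence
  by (simp add: matrix_vector_mult_def sum_mult_axis column_def)

lemma invertible_congruence:
  assumes "invertible A" "invertible (T :: 'a ^ 3 ^ 3)" "c \<noteq> 0"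
  shows "invertible (scale_mat c (star s T ** A ** T))"
  using assms by (intro invertible_scale_mat invertible_mult invertible_star)

lemma hermitian_relative_proj_equiv:
  assumes "hermitian_relative s F" "proj_equiv F (G :: 'a ternary)"
  shows "hermitian_relative s G"
proof -
  obtain A where A: "invertible A" "F = herm_form s A" using assms(1) hermitian_relative_iff by blast
  thus ?thesis
    using assms(2) invertible_congruence[OF A(1)]
    unfolding A(2) proj_equiv_herm_form hermitian_relative_iff by blast
qed

lemma proj_equiv_refl:
  assumes "hermitian_relative s (F :: 'a ternary)"
  shows "proj_equiv F F"
proof -
  obtain A where A: "F = herm_form s A" using assms hermitian_relative_iff by blast
  have "invertible (mat 1 :: 'a ^ 3 ^ 3)" by (auto simp: invertible_def)
  moreover have "A = scale_mat 1 (star s (mat 1) ** A ** mat 1)" by (simp add: star_mat_1)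
  ultimately show ?thesis unfolding A proj_equiv_herm_form by (metis one_neq_zero)
qed

lemma proj_equiv_trans:
  assumes "hermitian_relative s (F :: 'a ternary)" "proj_equiv F G" "proj_equiv G H"
  shows "proj_equiv F H"
proof -
  obtain A where A: "F = herm_form s A" using assms(1) hermitian_relative_iff by blast
  obtain T c where T: "invertible T" "c \<noteq> 0" "G = herm_form s (scale_mat c (star s T ** A ** T))"
    using assms(2) unfolding A proj_equiv_herm_form by blast
  obtain U d where U: "invertible U" "d \<noteq> 0"
    "H = herm_form s (scale_mat d (star s U ** scale_mat c (star s T ** A ** T) ** U))"
    using assms(3) unfolding T(3) proj_equiv_herm_form by blast
  have "H = herm_form s (scale_mat (d * c) (star s (T ** U) ** A ** (T ** U)))"
    unfolding U(3) by (simp add: scale_mat_mult_left scale_mat_mult_right star_mult matrix_mul_assoc)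
  thus ?thesis unfolding A proj_equiv_herm_form using T U invertible_mult
    by (metis mult_eq_0_iff)
qed

lemma proj_equiv_sym:
  assumes "hermitian_relative s (F :: 'a ternary)" "proj_equiv F G"
  shows "proj_equiv G F"
proof -
  obtain A where A: "F = herm_form s A" using assms(1) hermitian_relative_iff by blast
  obtain T c where T: "invertible T" "c \<noteq> 0" "G = herm_form s (scale_mat c (star s T ** A ** T))"
    using assms(2) unfolding A proj_equiv_herm_form by blast
  obtain U where U: "T ** U = mat 1" "U ** T = mat 1" using T(1) invertible_def by blast
  have "scale_mat (inverse c) (star s U ** scale_mat c (star s T ** A ** T) ** U) =
    star s (T ** U) ** A ** (T ** U)"
    using T(2) by (simp add: scale_mat_mult_left scale_mat_mult_right star_mult matrix_mul_assoc)
  hence "F = herm_form s (scale_mat (inverse c) (star s U ** scale_mat c (star s T ** A ** T) ** U))"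
    by (simp add: A U(1) star_mat_1)
  moreover have "invertible U" using U invertible_def by blast
  moreover have "inverse c \<noteq> 0" using T(2) by simp
  ultimately show ?thesis unfolding T(3) proj_equiv_herm_form by blast
qed

lemma card_lines_invertible:
  fixes T :: "'a ^ 3 ^ 3"
  assumes "invertible T"
  shows "card {vec.span {v} | v. P (T *v v)} = card {vec.span {v} | v. P v}"
proof -
  obtain U where U: "T ** U = mat 1" "U ** T = mat 1" using assms invertible_def by blast
  have span: "(*v) T ` vec.span {v} = vec.span {T *v v}" for v
    unfolding vec.span_singleton image_image
    by (simp add: vector_scalar_commute)
  have inj: "inj ((*v) T)"
    using assms by (rule inj_matrix_vector_mult)
  have "{vec.span {v} | v. P v} = ((`) ((*v) T)) ` {vec.span {v} | v. P (T *v v)}"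
  proof (intro set_eqI iffI)
    fix V assume "V \<in> {vec.span {v} | v. P v}"
    then obtain v where v: "V = vec.span {v}" "P v" by blast
    have "T *v (U *v v) = v" by (simp add: matrix_vector_mul_assoc U)
    hence "V = (*v) T ` vec.span {U *v v}" "P (T *v (U *v v))" using v by (simp_all add: span)
    thus "V \<in> ((`) ((*v) T)) ` {vec.span {v} | v. P (T *v v)}" by blast
  next
    fix V assume "V \<in> ((`) ((*v) T)) ` {vec.span {v} | v. P (T *v v)}"
    thus "V \<in> {vec.span {v} | v. P v}" using span by blast
  qed
  moreover have "inj_on ((`) ((*v) T)) X" for X
    using inj inj_image_eq_iff by (metis inj_onI)
  ultimately show ?thesis by (simp add: card_image)
qed

text \<open>
  The vectors satisfying the equations for \<open>F\<close> and \<open>G\<close> correspond under \<open>v \<mapsto> T v\<close>, since the form of the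
  congruent matrix at \<open>u\<close>, \<open>v\<close> is, up to the constant \<open>c\<close>, the form of \<open>A\<close> at \<open>T u\<close>, \<open>T v\<close>.
\<close>

lemma proj_equiv_card:
  assumes "hermitian_relative s (F :: 'a ternary)" "proj_equiv F G"
  shows "card (rational_points G) = card (rational_points F)"
    "card (rational_inflexions s G) = card (rational_inflexions s F)"
proof -
  obtain A where A: "invertible A" "F = herm_form s A" using assms(1) hermitian_relative_iff by blast
  obtain T c where T: "invertible T" "c \<noteq> 0" "G = herm_form s (scale_mat c (star s T ** A ** T))"
    using assms(2) unfolding A proj_equiv_herm_form by blast
  obtain U where U: "T ** U = mat 1" "U ** T = mat 1" using T(1) invertible_def by blast
  have T0: "T *v v = 0 \<longleftrightarrow> v = 0" for v
    by (metis U(2) matrix_vector_mul_assoc matrix_vector_mul_lid matrix_vector_mult_0_right)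
  have all: "(\<forall>w. Q (T *v w)) \<longleftrightarrow> (\<forall>w. Q w)" for Q
    by (metis U(1) matrix_vector_mul_assoc matrix_vector_mul_lid)
  have inv: "invertible (scale_mat c (star s T ** A ** T))"
    using A T by (intro invertible_congruence)
  have "inflexional s (scale_mat c (star s T ** A ** T)) v \<longleftrightarrow> inflexional s A (T *v v)" for v
    using all[of "\<lambda>w. sesq s A (T *v v) w = 0 \<longleftrightarrow> sesq s A w (T *v v) = 0"] T(2)
    by (simp add: inflexional_def T0 sesq_scale_mat sesq_congruence)
  thus "card (rational_inflexions s G) = card (rational_inflexions s F)"
    unfolding A(2) T(3) rational_inflexions_herm_form[OF A(1)] rational_inflexions_herm_form[OF inv]
    using card_lines_invertible[OF T(1), of "inflexional s A"] by simp
  show "card (rational_points G) = card (rational_points F)"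
    unfolding A(2) T(3) rational_points_herm_form
    using card_lines_invertible[OF T(1), of "\<lambda>v. v \<noteq> 0 \<and> sesq s A v v = 0"] T(2)
    by (simp add: T0 sesq_scale_mat sesq_congruence)
qed

subsection \<open>The normal form\<close>

definition C_mat :: "'a \<Rightarrow> 'a ^ 3 ^ 3" where
  "C_mat \<omega> = vector [vector [0, 1, 0], vector [\<omega>, 0, 0], vector [0, 0, 1]]"

definition D_mat :: "'a \<Rightarrow> 'a ^ 3 ^ 3" where
  "D_mat \<eta> = vector [vector [1, 0, 0], vector [0, 1, 0], vector [0, 0, \<eta>]]"

lemma C_mat_nth [simp]:
  "C_mat \<omega> $ 1 $ 1 = 0" "C_mat \<omega> $ 1 $ 2 = 1" "C_mat \<omega> $ 1 $ 3 = 0"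
  "C_mat \<omega> $ 2 $ 1 = \<omega>" "C_mat \<omega> $ 2 $ 2 = 0" "C_mat \<omega> $ 2 $ 3 = 0"
  "C_mat \<omega> $ 3 $ 1 = 0" "C_mat \<omega> $ 3 $ 2 = 0" "C_mat \<omega> $ 3 $ 3 = 1"
  by (simp_all add: C_mat_def)

lemma D_mat_nth [simp]:
  "D_mat \<omega> $ 1 $ 1 = 1" "D_mat \<omega> $ 1 $ 2 = 0" "D_mat \<omega> $ 1 $ 3 = 0"
  "D_mat \<omega> $ 2 $ 1 = 0" "D_mat \<omega> $ 2 $ 2 = 1" "D_mat \<omega> $ 2 $ 3 = 0"
  "D_mat \<omega> $ 3 $ 1 = 0" "D_mat \<omega> $ 3 $ 2 = 0" "D_mat \<omega> $ 3 $ 3 = \<omega>"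
  by (simp_all add: D_mat_def)

lemma invertible_C_mat: "\<omega> \<noteq> 0 \<Longrightarrow> invertible (C_mat \<omega>)"
  by (simp add: invertible_det_nz det_3)

lemma invertible_D_mat: "\<eta> \<noteq> 0 \<Longrightarrow> invertible (D_mat \<eta>)"
  by (simp add: invertible_det_nz det_3)

lemma Const_0_1: "Const (0::'a) = 0" "Const (1::'a) = 1"
  by (simp_all add: Const_def)

lemma C_curve_eq: "C_curve s \<omega> = herm_form s (C_mat \<omega>)"
  by (simp add: C_curve_def herm_form_def sum_3 Const_0_1 mult_ac)

lemma D_curve_eq: "D_curve s \<eta> = herm_form s (D_mat \<eta>)"
  by (simp add: D_curve_def herm_form_def sum_3 Const_0_1 mult_ac)

lemma hermitian_relative_C_curve: "\<omega> \<noteq> 0 \<Longrightarrow> hermitian_relative s (C_curve s (\<omega> :: 'a))"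
  unfolding hermitian_relative_iff C_curve_eq using invertible_C_mat by blast

lemma hermitian_relative_D_curve: "\<eta> \<noteq> 0 \<Longrightarrow> hermitian_relative s (D_curve s (\<eta> :: 'a))"
  unfolding hermitian_relative_iff D_curve_eq using invertible_D_mat by blast

text \<open>
  Dividing by \<open>M\<^sub>3\<^sub>3\<close> normalises that entry, and scaling \<open>x\<close> by \<open>\<lambda>\<close> with \<open>\<lambda>\<^sup>s = c / a\<close> normalises the
  coefficient of \<open>x\<^sup>s y\<close>.
\<close>

lemma antidiagonal_equiv_C_curve:
  fixes M :: "'a ^ 3 ^ 3"
  assumes "M $ 1 $ 1 = 0" "M $ 1 $ 2 = a" "M $ 1 $ 3 = 0"
    "M $ 2 $ 1 = b" "M $ 2 $ 2 = 0" "M $ 2 $ 3 = 0"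
    "M $ 3 $ 1 = 0" "M $ 3 $ 2 = 0" "M $ 3 $ 3 = c"
    and nz: "a \<noteq> 0" "b \<noteq> 0" "c \<noteq> 0"
  shows "proj_equiv (herm_form s M) (C_curve s (c ^ (s - 1) * b / a ^ s))"
proof -
  let ?l = "(c / a) ^ s"
  let ?T = "vector [vector [?l, 0, 0], vector [0, 1, 0], vector [0, 0, 1]] :: 'a ^ 3 ^ 3"
  have "invertible ?T" using nz by (simp add: invertible_det_nz det_3)
  moreover have "?l ^ s = c / a" by simp
  hence "scale_mat (inverse c) (star s ?T ** M ** ?T) = C_mat (c ^ (s - 1) * b / a ^ s)"
    using nz assms
    by (simp add: vec_eq_iff forall_3 scale_mat_def star_def transpose_def matrix_matrix_mult_def
        sum_3 power_divide power_s_eq_mult[of c] field_simps)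
  ultimately show ?thesis
    unfolding C_curve_eq proj_equiv_herm_form using nz(3)
    by (intro exI[of _ ?T] exI[of _ "inverse c"]) simp
qed

text \<open>
  Two inflexions \<open>v\<^sub>1\<close>, \<open>v\<^sub>2\<close> and the intersection point \<open>v\<^sub>3\<close> of their tangents form a basis in which the
  matrix of the curve is antidiagonal up to the entry at \<open>v\<^sub>3\<close>: left and right orthogonality agree
  at \<open>v\<^sub>1\<close> and \<open>v\<^sub>2\<close>, which kills all other entries.
\<close>

lemma two_inflexions_equiv_C_curve:
  assumes "hermitian_relative s (F :: 'a ternary)" "card (rational_inflexions s F) \<ge> 2"
  shows "\<exists>\<omega>. \<omega> \<noteq> 0 \<and> proj_equiv F (C_curve s \<omega>)"
proof -
  obtain A where A: "invertible A" "F = herm_form s A" using assms(1) hermitian_relative_iff by blast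
  have "\<not> is_singleton (rational_inflexions s F)" "rational_inflexions s F \<noteq> {}"
    using assms(2) by (auto simp: is_singleton_altdef)
  then obtain P Q where PQ: "P \<in> rational_inflexions s F" "Q \<in> rational_inflexions s F" "P \<noteq> Q"
    by (metis is_singletonI' all_not_in_conv)
  then obtain u v where uv: "inflexional s A u" "inflexional s A v" "vec.span {u} \<noteq> vec.span {v}"
    unfolding A(2) rational_inflexions_herm_form[OF A(1)] by blast
  let ?h = "sesq s A"
  have u: "u \<noteq> 0" "?h u u = 0" "\<And>w. ?h u w = 0 \<longleftrightarrow> ?h w u = 0"
    and v: "v \<noteq> 0" "?h v v = 0" "\<And>w. ?h v w = 0 \<longleftrightarrow> ?h w v = 0"
    using uv(1,2) unfolding inflexional_def by blast+
  have "v \<notin> vec.span {u}"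
  proof
    assume "v \<in> vec.span {u}"
    then obtain k where k: "v = k *s u" using span_singleton_iff by blast
    with v(1) have "k \<noteq> 0" by auto
    thus False using span_singleton_scale uv(3) k by metis
  qed
  hence huv: "?h u v \<noteq> 0" using no_isotropic_line[OF A(1) u(1)] u v by metis
  hence hvu: "?h v u \<noteq> 0" using u(3) by blast
  obtain w where w: "w \<noteq> 0" "?h u w = 0" "?h v w = 0"
  proof -
    let ?r = "\<lambda>x. (\<chi> j. \<Sum>i\<in>UNIV. x $ i ^ s * A $ i $ j)"
    \<comment> \<open>Two linear equations in three unknowns.\<close>
    let ?N = "vector [?r u, ?r v, 0] :: 'a ^ 3 ^ 3"
    have "\<not> invertible ?N" by (simp add: invertible_det_nz det_3)
    hence "\<not> (\<forall>w. ?N *v w = 0 \<longrightarrow> w = 0)"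
      unfolding invertible_left_inverse matrix_left_invertible_ker .
    then obtain w where w: "w \<noteq> 0" "?N *v w = 0" by blast
    have "(?N *v w) $ 1 = ?h u w" "(?N *v w) $ 2 = ?h v w"
      unfolding sesq_eq_functional by (simp_all add: matrix_vector_mult_def)
    hence "?h u w = 0" "?h v w = 0" unfolding w(2) by simp_all
    thus ?thesis using that \<open>w \<noteq> 0\<close> by blast
  qed
  have w': "?h w u = 0" "?h w v = 0" using w u(3) v(3) by blast+
  define T where "T = transpose (vector [u, v, w] :: 'a ^ 3 ^ 3)"
  have col: "column 1 T = u" "column 2 T = v" "column 3 T = w"
    by (simp_all add: T_def column_def transpose_def vec_eq_iff)
  have "invertible T"
    unfolding invertible_left_inverse matrix_left_invertible_ker
  proof (intro allI impI)
    fix x assume "T *v x = 0"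
    hence 0: "x $ 1 *s u + (x $ 2 *s v + x $ 3 *s w) = 0"
      by (simp add: T_def matrix_vector_mult_def transpose_def vec_eq_iff sum_3 mult.commute add.assoc)
    have "?h u (x $ 1 *s u + (x $ 2 *s v + x $ 3 *s w)) = x $ 2 * ?h u v"
      "?h v (x $ 1 *s u + (x $ 2 *s v + x $ 3 *s w)) = x $ 1 * ?h v u"
      unfolding sesq_add_right sesq_scale_right using u(2) v(2) w by simp_all
    moreover have "?h y 0 = 0" for y by (simp add: sesq_def)
    ultimately have "x $ 1 = 0" "x $ 2 = 0" unfolding 0 using huv hvu by auto
    moreover from this 0 w(1) have "x $ 3 = 0" by (auto simp: vec_eq_iff)
    ultimately show "x = 0" by (simp add: vec_eq_iff forall_3)
  qed
  define M where "M = star s T ** A ** T"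
  have M: "M $ 1 $ 1 = 0" "M $ 1 $ 2 = ?h u v" "M $ 1 $ 3 = 0"
    "M $ 2 $ 1 = ?h v u" "M $ 2 $ 2 = 0" "M $ 2 $ 3 = 0"
    "M $ 3 $ 1 = 0" "M $ 3 $ 2 = 0" "M $ 3 $ 3 = ?h w w"
    unfolding M_def congruence_entry col using u(2) v(2) w w' by simp_all
  have "invertible M"
    using invertible_congruence[OF A(1) \<open>invertible T\<close>, of 1] by (simp add: M_def)
  hence hww: "?h w w \<noteq> 0" by (auto simp: invertible_det_nz det_3 M)
  have "proj_equiv F (herm_form s M)"
    unfolding A(2) proj_equiv_herm_form M_def using \<open>invertible T\<close>
    by (intro exI[of _ T] exI[of _ 1]) simp
  moreover have "proj_equiv (herm_form s M) (C_curve s (?h w w ^ (s - 1) * ?h v u / ?h u v ^ s))"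
    using M huv hvu hww by (rule antidiagonal_equiv_C_curve)
  ultimately have "proj_equiv F (C_curve s (?h w w ^ (s - 1) * ?h v u / ?h u v ^ s))"
    using proj_equiv_trans[OF assms(1)] by blast
  thus ?thesis using huv hvu hww by (intro exI conjI) auto
qed

section \<open>Equivalences between the normal forms\<close>

lemma exists_transversal:
  fixes T :: "'a ^ 'n ^ 'n"
  assumes "det T \<noteq> 0"
  shows "\<exists>\<pi>. \<pi> permutes UNIV \<and> (\<forall>i. T $ i $ \<pi> i \<noteq> 0)"
proof -
  obtain \<pi> where \<pi>: "\<pi> \<in> {\<pi>. \<pi> permutes UNIV}" "of_int (sign \<pi>) * (\<Prod>i\<in>UNIV. T $ i $ \<pi> i) \<noteq> 0"
    using assms unfolding det_def by (rule sum.not_neutral_contains_not_neutral)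
  have "T $ i $ \<pi> i \<noteq> 0" for i
  proof
    assume "T $ i $ \<pi> i = 0"
    hence "(\<Prod>i\<in>UNIV. T $ i $ \<pi> i) = 0" by (intro prod_zero) auto
    thus False using \<pi>(2) by simp
  qed
  thus ?thesis using \<pi>(1) by blast
qed

definition diag_mat :: "('n \<Rightarrow> 'a) \<Rightarrow> 'a ^ 'n ^ 'n" where
  "diag_mat b = (\<chi> i j. if i = j then b i else 0)"

lemma mult_diag_mat_nth:
  "(M ** diag_mat b) $ i $ j = M $ i $ j * b j" "(diag_mat b ** M) $ i $ j = b i * M $ i $ j"
  by (simp_all add: matrix_matrix_mult_def diag_mat_def if_distrib if_distribR cong: if_cong)

text \<open>
  Under the congruence \<open>A' = c T\<^sup>* A T\<close> the matrix \<open>(A\<^sup>*)\<^bsup>-1\<^esup> A\<close> is conjugated by \<open>T\<close> and multiplied by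
  \<open>c\<^bsup>1 - s\<^esup>\<close>. If both matrices are diagonal, the conjugation can only permute the diagonal entries,
  as a nonzero term of the Leibniz formula for \<open>det T\<close> shows.
\<close>

lemma congruence_invariant:
  fixes A A' T :: "'a ^ 3 ^ 3"
  assumes A: "invertible A" "A = star s A ** diag_mat b" and A': "A' = star s A' ** diag_mat b'"
    and T: "invertible T" "c \<noteq> 0" "A' = scale_mat c (star s T ** A ** T)"
  shows "\<exists>\<pi>. \<pi> permutes UNIV \<and> (\<forall>i. c ^ (s - 1) * b' (\<pi> i) = b i)"
proof -
  let ?S = "star s T ** star s A"
  have sA': "star s A' = scale_mat (c ^ s) (?S ** T)"
    unfolding T(3) by (simp add: star_scale_mat star_mult star_star matrix_mul_assoc)
  have "scale_mat c (?S ** (diag_mat b ** T)) = scale_mat c (star s T ** (star s A ** diag_mat b) ** T)"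
    by (simp add: matrix_mul_assoc)
  also have "\<dots> = A'" unfolding A(2)[symmetric] T(3) ..
  also have "A' = scale_mat (c ^ s) (?S ** (T ** diag_mat b'))"
    by (subst A', subst sA') (simp add: scale_mat_mult_left matrix_mul_assoc)
  finally have eq: "?S ** scale_mat c (diag_mat b ** T) = ?S ** scale_mat (c ^ s) (T ** diag_mat b')"
    by (simp add: scale_mat_mult_right)
  have "invertible ?S" using A(1) T(1) by (intro invertible_mult invertible_star)
  then obtain R where "R ** ?S = mat 1" using invertible_def by blast
  hence eq': "scale_mat c (diag_mat b ** T) = scale_mat (c ^ s) (T ** diag_mat b')"
    using arg_cong[OF eq, of "(**) R"] by (simp only: matrix_mul_assoc) (simp add: matrix_mul_assoc)
  have entry: "c ^ (s - 1) * b' j = b i" if "T $ i $ j \<noteq> 0" for i j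
  proof -
    have "c * (b i * T $ i $ j) = c ^ s * (T $ i $ j * b' j)"
      using arg_cong[OF eq', of "\<lambda>M. M $ i $ j"] by (simp add: scale_mat_def mult_diag_mat_nth)
    thus ?thesis using that T(2) by (simp add: power_s_eq_mult)
  qed
  show ?thesis
    using exists_transversal[of T] T(1) entry by (metis invertible_det_nz)
qed

text \<open>
  The diagonal of \<open>(A\<^sup>*)\<^bsup>-1\<^esup> A\<close> for \<open>A = C_mat \<omega>\<close>.
\<close>

definition C_eigen :: "'a \<Rightarrow> 3 \<Rightarrow> 'a" where
  "C_eigen \<omega> i = (if i = 1 then \<omega> else if i = 2 then inverse (\<omega> ^ s) else 1)"

lemma C_mat_eq_star_mult: "\<omega> \<noteq> 0 \<Longrightarrow> C_mat \<omega> = star s (C_mat \<omega>) ** diag_mat (C_eigen \<omega>)"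
  unfolding vec_eq_iff mult_diag_mat_nth
  by (simp add: forall_3 star_def transpose_def C_eigen_def)

text \<open>
  The triples \<open>\<omega>, \<omega>\<^bsup>-s\<^esup>, 1\<close> and \<open>\<omega>', \<omega>'\<^bsup>-s\<^esup>, 1\<close> agree up to order and a factor \<open>\<mu>\<close> of norm \<open>1\<close>. If \<open>\<omega>'\<close>
  does not have norm \<open>1\<close>, then among the three entries only \<open>1\<close> has norm \<open>1\<close>, so \<open>\<mu> = 1\<close>.
\<close>

lemma C_curve_equivD:
  assumes nz: "\<omega> \<noteq> 0" "\<omega>' \<noteq> (0::'a)" and eq: "proj_equiv (C_curve s \<omega>) (C_curve s \<omega>')"
  shows "\<omega>' = \<omega> \<or> \<omega>' = inverse (\<omega> ^ s)"
proof -
  obtain T c where T: "invertible T" "c \<noteq> 0" "C_mat \<omega>' = scale_mat c (star s T ** C_mat \<omega> ** T)"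
    using eq unfolding C_curve_eq proj_equiv_herm_form herm_form_inject[OF s_ge_2] by blast
  obtain \<pi> where \<pi>: "\<pi> permutes UNIV" "\<And>i. c ^ (s - 1) * C_eigen \<omega>' (\<pi> i) = C_eigen \<omega> i"
    using congruence_invariant[OF invertible_C_mat C_mat_eq_star_mult C_mat_eq_star_mult T] nz by blast
  let ?\<mu> = "c ^ (s - 1)"
  have inj: "i = j" if "\<pi> i = \<pi> j" for i j
    using permutes_inj[OF \<pi>(1)] that by (rule injD)
  have \<mu>: "?\<mu> ^ (s + 1) = 1" by (rule unit_power_Nm) fact
  show ?thesis
  proof (cases "\<pi> 3 = 3")
    case True
    hence "?\<mu> = 1" using \<pi>(2)[of 3] by (simp add: C_eigen_def)
    hence "C_eigen \<omega>' (\<pi> 1) = \<omega>" using \<pi>(2)[of 1] by (simp add: C_eigen_def)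
    moreover have "\<pi> 1 \<noteq> 3" using inj[of 1 3] True by auto
    ultimately have "\<omega>' = \<omega> \<or> inverse (\<omega>' ^ s) = \<omega>"
      using exhaust_3[of "\<pi> 1"] by (auto simp: C_eigen_def split: if_splits)
    thus ?thesis by (auto simp: power_inverse)
  next
    case False
    \<comment> \<open>Here \<open>\<mu>\<close> maps \<open>\<omega>'\<close> or its conjugate inverse to \<open>1\<close>, so \<open>\<omega>'\<close> has norm \<open>1\<close> and is a double
      eigenvalue. It is matched with the eigenvalue \<open>1\<close> at index \<open>3\<close> and with an eigenvalue
      at index \<open>1\<close> or \<open>2\<close>, which is therefore \<open>1\<close> as well, and both \<open>\<omega>\<close> and \<open>\<omega>'\<close> turn out to be \<open>1\<close>.\<close>
    hence "?\<mu> * \<omega>' = 1 \<or> ?\<mu> * inverse (\<omega>' ^ s) = 1"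
      using \<pi>(2)[of 3] exhaust_3[of "\<pi> 3"] by (auto simp: C_eigen_def)
    hence "(?\<mu> * \<omega>') ^ (s + 1) = 1 \<or> (?\<mu> * inverse (\<omega>' ^ s)) ^ (s + 1) = 1" by (metis power_one)
    hence "\<omega>' ^ (s + 1) = 1 \<or> inverse (\<omega>' ^ s) ^ (s + 1) = 1"
      unfolding power_mult_distrib \<mu> by simp
    hence "\<omega>' ^ s * \<omega>' = 1"
      using nz(2) by (auto simp: power_inverse field_simps)
    hence eig': "C_eigen \<omega>' i = \<omega>'" if "i \<noteq> 3" for i
    proof (cases "i = 1")
      case False
      hence "C_eigen \<omega>' i = inverse (\<omega>' ^ s)" using that exhaust_3[of i] by (simp add: C_eigen_def)
      also have "\<dots> = \<omega>'" using \<open>\<omega>' ^ s * \<omega>' = 1\<close> by (rule inverse_unique)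
      finally show ?thesis .
    qed (simp add: C_eigen_def)
    obtain j where j: "\<pi> j = 3" using permutes_surj[OF \<pi>(1)] by (metis surjD)
    have "j \<noteq> 3" using j False by auto
    define i :: 3 where "i = (if j = 1 then 2 else 1)"
    have ij: "i \<noteq> 3" "i \<noteq> j" by (auto simp: i_def)
    have "\<pi> i \<noteq> 3" using j ij(2) inj[of i j] by auto
    hence "C_eigen \<omega> i = ?\<mu> * \<omega>'" using \<pi>(2)[of i] eig' by simp
    moreover have "?\<mu> * \<omega>' = 1" using \<pi>(2)[of 3] False eig' by (simp add: C_eigen_def)
    ultimately have "C_eigen \<omega> i = 1" by simp
    hence "\<omega> = 1 \<or> \<omega> ^ s = 1 ^ s" using ij(1) exhaust_3[of i] by (auto simp: C_eigen_def)
    hence "\<omega> = 1" using frob_eq_iff by blast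
    hence "?\<mu> = 1" using \<pi>(2)[of j] j \<open>j \<noteq> 3\<close> exhaust_3[of j] by (auto simp: C_eigen_def)
    thus ?thesis using \<open>?\<mu> * \<omega>' = 1\<close> \<open>\<omega> = 1\<close> by simp
  qed
qed

lemma C_curve_equiv_swap:
  assumes "\<omega> \<noteq> (0::'a)"
  shows "proj_equiv (C_curve s \<omega>) (C_curve s (inverse (\<omega> ^ s)))"
proof -
  let ?T = "vector [vector [0, 1, 0], vector [1, 0, 0], vector [0, 0, 1]] :: 'a ^ 3 ^ 3"
  let ?M = "star s ?T ** C_mat \<omega> ** ?T"
  have "invertible ?T" by (simp add: invertible_det_nz det_3)
  hence "proj_equiv (C_curve s \<omega>) (herm_form s ?M)"
    unfolding C_curve_eq proj_equiv_herm_form by (metis one_neq_zero scale_mat_1)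
  moreover have "proj_equiv (herm_form s ?M) (C_curve s (1 ^ (s - 1) * 1 / \<omega> ^ s))"
    by (rule antidiagonal_equiv_C_curve)
      (use assms in \<open>simp_all add: star_def transpose_def matrix_matrix_mult_def sum_3\<close>)
  ultimately show ?thesis
    using proj_equiv_trans[OF hermitian_relative_C_curve[OF assms]]
    by (simp add: inverse_eq_divide)
qed

lemma C_curve_equiv_iff:
  assumes "\<omega> \<noteq> 0" "\<omega>' \<noteq> (0::'a)"
  shows "proj_equiv (C_curve s \<omega>) (C_curve s \<omega>') \<longleftrightarrow> \<omega>' = \<omega> \<or> \<omega>' = inverse (\<omega> ^ s)"
  using C_curve_equivD[OF assms] C_curve_equiv_swap[OF assms(1)]
    proj_equiv_refl[OF hermitian_relative_C_curve[OF assms(1)]] by blast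

text \<open>
  On the line \<open>z = 0\<close> the curve \<open>D\<^sub>\<eta>\<close> has the points \<open>(1 : \<epsilon> : 0)\<close> with \<open>\<epsilon>\<^bsup>s + 1\<^esup> = -1\<close>, which do not
  depend on \<open>\<eta>\<close>. Two of them, together with \<open>(0 : 0 : 1)\<close>, make the matrix antidiagonal.
\<close>

lemma D_curve_equiv_C_curve:
  assumes "\<eta> \<noteq> (0::'a)"
  shows "proj_equiv (D_curve s \<eta>) (C_curve s (\<eta> ^ (s - 1)))"
proof -
  have "card {x::'a. x ^ (s + 1) = - 1} = s + 1" by (rule card_Nm_fibre) (simp_all add: minus_1_s)
  hence "\<not> (\<exists>e. {x::'a. x ^ (s + 1) = - 1} \<subseteq> {e})"
    using s_ge_2 card_mono[of "{_}" "{x::'a. x ^ (s + 1) = - 1}"] by fastforce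
  then obtain e f :: 'a where ef: "e ^ (s + 1) = - 1" "f ^ (s + 1) = - 1" "e \<noteq> f"
    by blast
  let ?T = "vector [vector [1, 1, 0], vector [e, f, 0], vector [0, 0, 1]] :: 'a ^ 3 ^ 3"
  let ?M = "star s ?T ** D_mat \<eta> ** ?T"
  let ?a = "1 + e ^ s * f"
  have a0: "?a \<noteq> 0"
  proof
    assume "?a = 0"
    hence "e ^ s * f = e ^ s * e" using ef(1) by (simp add: add_eq_0_iff mult.commute)
    thus False using ef by auto
  qed
  have "invertible ?T" using ef(3) by (simp add: invertible_det_nz det_3)
  hence "proj_equiv (D_curve s \<eta>) (herm_form s ?M)"
    unfolding D_curve_eq proj_equiv_herm_form by (metis one_neq_zero scale_mat_1)
  moreover have "proj_equiv (herm_form s ?M) (C_curve s (\<eta> ^ (s - 1) * ?a ^ s / ?a ^ s))"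
  proof (rule antidiagonal_equiv_C_curve)
    show "?a \<noteq> 0" "?a ^ s \<noteq> 0" using a0 by simp_all
  qed (use ef assms in \<open>simp_all add: star_def transpose_def matrix_matrix_mult_def sum_3 frob_add
        power_mult_distrib mult_ac\<close>)
  ultimately have "proj_equiv (D_curve s \<eta>) (C_curve s (\<eta> ^ (s - 1) * ?a ^ s / ?a ^ s))"
    using proj_equiv_trans[OF hermitian_relative_D_curve[OF assms]] by blast
  thus ?thesis using a0 by simp
qed

section \<open>Points and inflexions of the normal forms\<close>

lemma sesq_C_mat:
  "sesq s (C_mat \<omega>) u v = u $ 1 ^ s * v $ 2 + \<omega> * u $ 2 ^ s * v $ 1 + u $ 3 ^ s * v $ 3"
  by (simp add: sesq_def sum_3 mult_ac)

lemma sesq_C_mat_power_s: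
  "sesq s (C_mat \<omega>) w v ^ s = w $ 1 * v $ 2 ^ s + \<omega> ^ s * w $ 2 * v $ 1 ^ s + w $ 3 * v $ 3 ^ s"
  by (simp add: sesq_C_mat frob_add power_mult_distrib)

lemma sesq_swap_eq_0_iff:
  "sesq s (C_mat \<omega>) w v = 0 \<longleftrightarrow>
    w $ 1 * v $ 2 ^ s + \<omega> ^ s * w $ 2 * v $ 1 ^ s + w $ 3 * v $ 3 ^ s = 0"
  unfolding sesq_C_mat_power_s[symmetric] by simp

text \<open>
  The matrix is Hermitian: exchanging the arguments of the form raises it to the \<open>s\<close>-th power.
\<close>

lemma inflexional_C_mat_1:
  assumes "v \<noteq> 0" "sesq s (C_mat 1) v v = 0"
  shows "inflexional s (C_mat 1) v"
proof -
  have "sesq s (C_mat 1) w v ^ s = sesq s (C_mat 1) v w" for w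
    by (simp add: sesq_C_mat frob_add power_mult_distrib mult_ac)
  thus ?thesis using assms power_s_eq_0 unfolding inflexional_def by metis
qed

lemma inflexional_C_mat_norm_1:
  assumes \<omega>: "\<omega> * \<omega> ^ s = 1" and v: "v \<noteq> 0" "sesq s (C_mat \<omega>) v v = 0" "v $ 3 = 0"
  shows "inflexional s (C_mat \<omega>) v"
proof -
  have eq: "w $ 1 * v $ 2 ^ s + \<omega> ^ s * w $ 2 * v $ 1 ^ s + w $ 3 * v $ 3 ^ s =
      \<omega> ^ s * sesq s (C_mat \<omega>) v w" for w
  proof -
    have "\<omega> ^ s * sesq s (C_mat \<omega>) v w =
        (\<omega> * \<omega> ^ s) * (v $ 2 ^ s * w $ 1) + \<omega> ^ s * (v $ 1 ^ s * w $ 2)"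
      using v(3) by (simp add: sesq_C_mat algebra_simps)
    thus ?thesis using v(3) unfolding \<omega> by (simp add: mult_ac)
  qed
  have "\<omega> \<noteq> 0" using \<omega> by auto
  hence "sesq s (C_mat \<omega>) v w = 0 \<longleftrightarrow> sesq s (C_mat \<omega>) w v = 0" for w
    by (subst (2) sesq_swap_eq_0_iff) (simp add: eq)
  thus ?thesis using v unfolding inflexional_def by blast
qed

text \<open>
  At an inflexion the linear functionals \<open>(\<omega> y\<^sup>s, x\<^sup>s, z\<^sup>s)\<close> and \<open>(y\<^sup>s, \<omega>\<^sup>s x\<^sup>s, z\<^sup>s)\<close> have the same kernel. If
  \<open>z \<noteq> 0\<close>, they must coincide, which for \<open>\<omega> \<noteq> 1\<close> forces \<open>x = y = 0\<close>. The vectors in the proof lie in the first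
  kernel and test the \<open>2 \<times> 2\<close> minors.
\<close>

lemma inflexional_imp_third_0:
  assumes "inflexional s (C_mat \<omega>) v" "\<omega> \<noteq> 1"
  shows "v $ 3 = 0"
proof (rule ccontr)
  assume z: "v $ 3 \<noteq> 0"
  have v: "sesq s (C_mat \<omega>) v v = 0" "\<And>w. sesq s (C_mat \<omega>) v w = 0 \<Longrightarrow> sesq s (C_mat \<omega>) w v = 0"
    using assms(1) by (auto simp: inflexional_def)
  have "sesq s (C_mat \<omega>) v (vector [v $ 3 ^ s, 0, - (\<omega> * v $ 2 ^ s)]) = 0"
    by (simp add: sesq_C_mat)
  from v(2)[OF this] have "(1 - \<omega>) * (v $ 3 ^ s * v $ 2 ^ s) = 0"
    unfolding sesq_swap_eq_0_iff by (simp add: algebra_simps)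
  hence y: "v $ 2 = 0" using z assms(2) by simp
  have "sesq s (C_mat \<omega>) v (vector [0, v $ 3 ^ s, - (v $ 1 ^ s)]) = 0"
    by (simp add: sesq_C_mat)
  from v(2)[OF this] have "(\<omega> ^ s - 1 ^ s) * (v $ 3 ^ s * v $ 1 ^ s) = 0"
    unfolding sesq_swap_eq_0_iff by (simp add: algebra_simps)
  hence "v $ 1 = 0" using z assms(2) by (simp del: power_one)
  thus False using v(1) y z by (simp add: sesq_C_mat)
qed

lemma inflexional_C_mat_axis:
  assumes "\<omega> \<noteq> 0"
  shows "inflexional s (C_mat \<omega>) (axis 1 1)" "inflexional s (C_mat \<omega>) (axis 2 1)"
  using assms by (simp_all add: inflexional_def sesq_C_mat axis_def vec_eq_iff)

text \<open>
  With \<open>z = 0\<close> the remaining minor of the two functionals is \<open>(1 - \<omega>\<^bsup>s + 1\<^esup>) x\<^sup>s y\<^sup>s\<close> up to sign.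
\<close>

lemma inflexional_imp_axis:
  assumes infl: "inflexional s (C_mat \<omega>) v" and \<omega>: "\<omega> * \<omega> ^ s \<noteq> 1"
  shows "vec.span {v} = vec.span {axis 1 1} \<or> vec.span {v} = vec.span {axis 2 1}"
proof -
  have v: "v \<noteq> 0" "\<And>w. sesq s (C_mat \<omega>) v w = 0 \<Longrightarrow> sesq s (C_mat \<omega>) w v = 0"
    using infl by (auto simp: inflexional_def)
  have "\<omega> \<noteq> 1" using \<omega> by force
  hence z: "v $ 3 = 0" using inflexional_imp_third_0[OF infl] by blast
  have "sesq s (C_mat \<omega>) v (vector [v $ 1 ^ s, - (\<omega> * v $ 2 ^ s), 0]) = 0"
    by (simp add: sesq_C_mat)
  from v(2)[OF this] have "(1 - \<omega> * \<omega> ^ s) * (v $ 1 ^ s * v $ 2 ^ s) = 0"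
    unfolding sesq_swap_eq_0_iff by (simp add: algebra_simps)
  hence "v $ 1 = 0 \<or> v $ 2 = 0" using \<omega> by simp
  hence "v = v $ 1 *s axis 1 1 \<and> v $ 1 \<noteq> 0 \<or> v = v $ 2 *s axis 2 1 \<and> v $ 2 \<noteq> 0"
    using v(1) z by (auto simp: vec_eq_iff forall_3 axis_def)
  thus ?thesis using span_singleton_scale by metis
qed

lemma span_axis_neq: "vec.span {axis 1 1} \<noteq> vec.span {axis 2 1 :: 'a ^ 3}"
proof
  assume "vec.span {axis 1 1} = vec.span {axis 2 1 :: 'a ^ 3}"
  moreover have "axis 1 1 \<in> vec.span {axis 1 1 :: 'a ^ 3}" by (rule vec.span_base) simp
  ultimately obtain k where "axis 1 1 = k *s (axis 2 1 :: 'a ^ 3)" using span_singleton_iff by blast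
  hence "(axis 1 1 :: 'a ^ 3) $ 1 = (k *s axis 2 1 :: 'a ^ 3) $ 1" by simp
  thus False by (simp add: axis_def)
qed

lemma two_le_card_rational_inflexions_C_curve:
  assumes "\<omega> \<noteq> (0::'a)"
  shows "card (rational_inflexions s (C_curve s \<omega>)) \<ge> 2"
proof -
  have "{vec.span {axis 1 1}, vec.span {axis 2 1}} \<subseteq> rational_inflexions s (C_curve s \<omega>)"
    unfolding C_curve_eq rational_inflexions_herm_form[OF invertible_C_mat[OF assms]]
    using inflexional_C_mat_axis[OF assms] by blast
  from card_mono[OF _ this] show ?thesis using span_axis_neq by simp
qed

lemma card_rational_inflexions_C_curve:
  assumes "\<omega> \<noteq> (0::'a)" "\<omega> * \<omega> ^ s \<noteq> 1"
  shows "card (rational_inflexions s (C_curve s \<omega>)) = 2"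
proof -
  have "rational_inflexions s (C_curve s \<omega>) \<subseteq> {vec.span {axis 1 1}, vec.span {axis 2 1}}"
    unfolding C_curve_eq rational_inflexions_herm_form[OF invertible_C_mat[OF assms(1)]]
    using inflexional_imp_axis[OF _ assms(2)] by blast
  from card_mono[OF _ this] show ?thesis
    using two_le_card_rational_inflexions_C_curve[OF assms(1)] span_axis_neq by simp
qed

lemma C_mat_dehomogenise:
  assumes "v $ 1 \<noteq> 0" "sesq s (C_mat \<omega>) v v = 0"
  shows "v $ 2 / v $ 1 + \<omega> * (v $ 2 / v $ 1) ^ s = - ((v $ 3 / v $ 1) ^ (s + 1))"
    "v = v $ 1 *s vector [1, v $ 2 / v $ 1, v $ 3 / v $ 1]"
proof -
  let ?w = "vector [1, v $ 2 / v $ 1, v $ 3 / v $ 1] :: 'a ^ 3"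
  show vw: "v = v $ 1 *s ?w" using assms(1) by (simp add: vec_eq_iff forall_3)
  have "v $ 1 ^ s * (v $ 1 * sesq s (C_mat \<omega>) ?w ?w) = sesq s (C_mat \<omega>) (v $ 1 *s ?w) (v $ 1 *s ?w)"
    by (simp only: sesq_scale_left sesq_scale_right mult_ac)
  also have "\<dots> = 0" using assms(2) unfolding vw[symmetric] .
  finally have "sesq s (C_mat \<omega>) ?w ?w = 0" using assms(1) by simp
  thus "v $ 2 / v $ 1 + \<omega> * (v $ 2 / v $ 1) ^ s = - ((v $ 3 / v $ 1) ^ (s + 1))"
    by (simp add: sesq_C_mat eq_neg_iff_add_eq_0 mult_ac)
qed

text \<open>
  The line \<open>x = 0\<close> meets the curve in \<open>(0 : 1 : 0)\<close> only; the other points are counted in the chart \<open>x = 1\<close>. Everything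
  then depends on the additive map \<open>y \<mapsto> y + \<omega> y\<^sup>s\<close>: it is the trace for \<open>\<omega> = 1\<close>, and it is bijective
  iff \<open>\<omega>\<close> does not have norm \<open>1\<close>.
\<close>

lemma card_rational_points_C_curve:
  "card (rational_points (C_curve s \<omega>)) = 1 + card {(y, z :: 'a). y + \<omega> * y ^ s = - (z ^ (s + 1))}"
proof -
  let ?E = "{(y, z :: 'a). y + \<omega> * y ^ s = - (z ^ (s + 1))}"
  let ?f = "\<lambda>(y, z). vec.span {vector [1, y, z] :: 'a ^ 3}"
  have E: "(y, z) \<in> ?E \<longleftrightarrow> sesq s (C_mat \<omega>) (vector [1, y, z]) (vector [1, y, z]) = 0" for y z
    by (simp add: sesq_C_mat add_eq_0_iff eq_neg_iff_add_eq_0 mult_ac)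
  have "rational_points (C_curve s \<omega>) = insert (vec.span {axis 2 1}) (?f ` ?E)"
    unfolding C_curve_eq rational_points_herm_form
  proof (intro set_eqI iffI)
    fix V assume "V \<in> {vec.span {v} | v. v \<noteq> 0 \<and> sesq s (C_mat \<omega>) v v = 0}"
    then obtain v where v: "V = vec.span {v}" "v \<noteq> 0" "sesq s (C_mat \<omega>) v v = 0" by blast
    show "V \<in> insert (vec.span {axis 2 1}) (?f ` ?E)"
    proof (cases "v $ 1 = 0")
      case True
      hence "v $ 3 = 0" using v(3) by (simp add: sesq_C_mat)
      hence *: "v = v $ 2 *s axis 2 1" "v $ 2 \<noteq> 0"
        using True v(2) by (auto simp: vec_eq_iff forall_3 axis_def)
      have "V = vec.span {axis 2 1}"
        unfolding v(1) by (subst *(1)) (rule span_singleton_scale[OF *(2)])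
      thus ?thesis by blast
    next
      case False
      from C_mat_dehomogenise[OF this v(3)]
      have "(v $ 2 / v $ 1, v $ 3 / v $ 1) \<in> ?E"
        and vw: "v = v $ 1 *s vector [1, v $ 2 / v $ 1, v $ 3 / v $ 1]" by auto
      moreover have "V = vec.span {vector [1, v $ 2 / v $ 1, v $ 3 / v $ 1]}"
        unfolding v(1) by (subst vw) (rule span_singleton_scale[OF False])
      ultimately show ?thesis by (intro insertI2 image_eqI[where x = "(v $ 2 / v $ 1, v $ 3 / v $ 1)"]) auto
    qed
  next
    fix V assume "V \<in> insert (vec.span {axis 2 1}) (?f ` ?E)"
    then consider "V = vec.span {axis 2 1}" | y z where "V = vec.span {vector [1, y, z]}" "(y, z) \<in> ?E"
      by auto
    thus "V \<in> {vec.span {v} | v. v \<noteq> 0 \<and> sesq s (C_mat \<omega>) v v = 0}"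
    proof cases
      case 1
      thus ?thesis by (intro CollectI exI[of _ "axis 2 1"]) (simp add: sesq_C_mat axis_def vec_eq_iff)
    next
      case 2
      have "vector [1, y, z] \<noteq> (0 :: 'a ^ 3)" by (simp add: vec_eq_iff forall_3)
      thus ?thesis using 2 E by blast
    qed
  qed
  moreover have unique: "u = k *s v" if "vec.span {u} = vec.span {v}" "k = u $ 1 / v $ 1" "v $ 1 \<noteq> 0"
    for u v :: "'a ^ 3" and k
  proof -
    have "u \<in> vec.span {u}" by (rule vec.span_base) simp
    hence "u \<in> vec.span {v}" unfolding that(1) .
    then obtain l where l: "u = l *s v" unfolding span_singleton_iff by blast
    hence "u $ 1 = l * v $ 1" by simp
    hence "k = l" using that(2,3) by simp
    thus ?thesis using l by simp
  qed
  have "inj_on ?f ?E"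
  proof (rule inj_onI, clarify)
    fix y z y' z' assume "vec.span {vector [1, y, z] :: 'a ^ 3} = vec.span {vector [1, y', z']}"
    from unique[OF this refl] have "vector [1, y, z] = (vector [1, y', z'] :: 'a ^ 3)" by simp
    thus "y = y' \<and> z = z'" by (simp add: vec_eq_iff forall_3)
  qed
  moreover have "vec.span {axis 2 1} \<notin> ?f ` ?E"
  proof
    assume "vec.span {axis 2 1} \<in> ?f ` ?E"
    then obtain y z where "vec.span {axis 2 1} = vec.span {vector [1, y, z] :: 'a ^ 3}" by auto
    from unique[OF this refl] have "axis 2 1 = (0 :: 'a ^ 3)" by (simp add: axis_def)
    thus False by (simp add: axis_eq_0_iff)
  qed
  ultimately show ?thesis by (simp add: card_image)
qed

lemma card_kernel:
  assumes "\<omega> * \<omega> ^ s = (1::'a)"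
  shows "card {y. y + \<omega> * y ^ s = 0} = s"
proof -
  have nz: "\<omega> \<noteq> 0" using assms by auto
  have "y + \<omega> * y ^ s = 0 \<longleftrightarrow> y = 0 \<or> y ^ (s - 1) = - inverse \<omega>" for y
  proof -
    have "y + \<omega> * y ^ s = (1 + \<omega> * y ^ (s - 1)) * y"
      by (simp add: power_s_eq_mult algebra_simps)
    moreover have "1 + \<omega> * y ^ (s - 1) = 0 \<longleftrightarrow> y ^ (s - 1) = - inverse \<omega>"
      using nz by (auto simp: field_simps add_eq_0_iff)
    ultimately show ?thesis by auto
  qed
  hence "{y. y + \<omega> * y ^ s = 0} = insert 0 {y. y ^ (s - 1) = - inverse \<omega>}" by auto
  moreover have "0 \<notin> {y. y ^ (s - 1) = - inverse \<omega>}" using nz s_ge_2 by (auto simp: power_0_left)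
  moreover have "(- inverse \<omega>) ^ (s + 1) = 1"
    using assms nz by (simp add: frob_uminus power_inverse field_simps)
  ultimately show ?thesis using card_Hilbert90_fibre[of "- inverse \<omega>"] s_ge_2 by simp
qed

text \<open>
  A nonempty fibre is a translate of the kernel, and the trace takes values in the fixed field, which has \<open>s\<close> elements.
\<close>

lemma card_trace_fibre:
  assumes "(c::'a) ^ s = c"
  shows "card {y. y + y ^ s = c} = s"
proof -
  have "card {y \<in> UNIV. y + y ^ s = c} = s"
  proof (rule card_fibre_eq[where U = "{c. c ^ s = c}" and e = s])
    show "card {y \<in> UNIV. y + y ^ s = d} \<le> s" for d :: 'a
    proof (cases "\<exists>x. x + x ^ s = d")
      case True
      then obtain x where "x + x ^ s = d" by blast
      hence "y - x \<in> {y. y + 1 * y ^ s = 0}" if "y + y ^ s = d" for y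
        using that by (simp add: frob_diff algebra_simps)
      hence "{y. y + y ^ s = d} \<subseteq> (+) x ` {y. y + 1 * y ^ s = 0}"
        by (intro subsetI image_eqI[where x = "_ - x"]) auto
      from card_mono[OF _ this] show ?thesis
        using card_kernel[of 1] card_image_le[of "{y. y + 1 * y ^ s = 0}" "(+) x"] by simp
    qed simp
  qed (use assms in \<open>auto simp: card_fixed_field card_field power2_eq_square frob_add add.commute\<close>)
  thus ?thesis by simp
qed

lemma card_solutions:
  "card {(y, z :: 'a). P y z} = (\<Sum>z\<in>UNIV. card {y :: 'a. P y z})"
proof -
  have "{(y, z). P y z} = prod.swap ` (SIGMA z:UNIV. {y. P y z})" by (auto simp: image_iff)
  thus ?thesis by (simp add: card_image)
qed

lemma Nm_fixed: "(z ^ (s + 1)) ^ s = (z::'a) ^ (s + 1)"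
  by (simp add: power_mult_distrib)

lemma card_rational_points_C_curve_1: "card (rational_points (C_curve s (1::'a))) = s ^ 3 + 1"
proof -
  have "card {y. y + y ^ s = - (z ^ (s + 1))} = s" for z :: 'a
    by (rule card_trace_fibre) (simp only: frob_uminus Nm_fixed)
  thus ?thesis
    by (simp add: card_rational_points_C_curve card_solutions card_field power_numeral_reduce
        del: power_Suc)
qed

text \<open>
  If \<open>\<omega>\<close> has norm \<open>1\<close>, the values \<open>u = y + \<omega> y\<^sup>s\<close> satisfy \<open>\<omega> u\<^sup>s = u\<close>, whereas norms satisfy \<open>u\<^sup>s = u\<close>. For
  \<open>\<omega> \<noteq> 1\<close> only \<open>u = 0\<close> does both.
\<close>

lemma C_norm_1_solution_third_0:
  assumes "\<omega> * \<omega> ^ s = 1" "\<omega> \<noteq> 1" "y + \<omega> * y ^ s = - (z ^ (s + 1))"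
  shows "z = (0::'a)"
proof -
  have "\<omega> * (y + \<omega> * y ^ s) ^ s = (\<omega> * \<omega> ^ s) * y + \<omega> * y ^ s"
    by (simp add: frob_add power_mult_distrib algebra_simps)
  hence "\<omega> * (y + \<omega> * y ^ s) ^ s = y + \<omega> * y ^ s" using assms(1) by simp
  hence "(\<omega> - 1) * z ^ (s + 1) = 0"
    unfolding assms(3) frob_uminus Nm_fixed by (simp add: algebra_simps)
  thus ?thesis using assms(2) by simp
qed

lemma card_rational_points_C_curve_norm_1:
  assumes "\<omega> * \<omega> ^ s = 1" "\<omega> \<noteq> (1::'a)"
  shows "card (rational_points (C_curve s \<omega>)) = s + 1"
proof -
  have "{(y, z). y + \<omega> * y ^ s = - (z ^ (s + 1))} = {y. y + \<omega> * y ^ s = 0} \<times> {0}"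
    using C_norm_1_solution_third_0[OF assms] by auto
  thus ?thesis using card_kernel[OF assms(1)]
    by (simp add: card_rational_points_C_curve card_cartesian_product)
qed

lemma card_rational_points_C_curve_other:
  assumes "\<omega> * \<omega> ^ s \<noteq> (1::'a)"
  shows "card (rational_points (C_curve s \<omega>)) = s ^ 2 + 1"
proof -
  let ?L = "\<lambda>y. y + \<omega> * y ^ s"
  have "inj ?L"
  proof (rule injI)
    fix x y assume "?L x = ?L y"
    hence "x - y = - \<omega> * (x - y) ^ s" by (simp add: frob_diff algebra_simps add_eq_0_iff)
    moreover from arg_cong[OF this, of "\<lambda>x. x ^ s"]
    have "(x - y) ^ s = - (\<omega> ^ s * (x - y))" by (simp add: frob_uminus power_mult_distrib)
    ultimately have "(1 - \<omega> * \<omega> ^ s) * (x - y) = 0" by (simp add: algebra_simps)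
    thus "x = y" using assms by simp
  qed
  hence "surj ?L" by (simp add: finite_UNIV_inj_surj)
  have "card {y. ?L y = c} = 1" for c
  proof -
    obtain y where y: "c = ?L y" using \<open>surj ?L\<close> by (rule surjE)
    have "{x. ?L x = c} = {y}" unfolding y using injD[OF \<open>inj ?L\<close>] by blast
    thus ?thesis by simp
  qed
  thus ?thesis by (simp add: card_rational_points_C_curve card_solutions card_field)
qed

lemma rational_points_subset_inflexions_1:
  "rational_points (C_curve s (1::'a)) \<subseteq> rational_inflexions s (C_curve s 1)"
  unfolding C_curve_eq rational_points_herm_form rational_inflexions_herm_form[OF invertible_C_mat[OF one_neq_zero]]
  using inflexional_C_mat_1 by blast

lemma rational_points_subset_inflexions_norm_1:
  assumes "\<omega> * \<omega> ^ s = 1" "\<omega> \<noteq> (1::'a)"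
  shows "rational_points (C_curve s \<omega>) \<subseteq> rational_inflexions s (C_curve s \<omega>)"
proof -
  have \<omega>: "\<omega> \<noteq> 0" using assms(1) by auto
  have "v $ 3 = 0" if v: "sesq s (C_mat \<omega>) v v = 0" for v
  proof (cases "v $ 1 = 0")
    case True
    thus ?thesis using v by (simp add: sesq_C_mat)
  next
    case False
    from C_norm_1_solution_third_0[OF assms C_mat_dehomogenise(1)[OF this v]] show ?thesis using False by simp
  qed
  thus ?thesis
    unfolding C_curve_eq rational_points_herm_form rational_inflexions_herm_form[OF invertible_C_mat[OF \<omega>]]
    using inflexional_C_mat_norm_1[OF assms(1)] by blast
qed

lemma hermitian_C_curve_1: "hermitian s (C_curve s (1::'a))"
proof -
  have "C_mat 1 = star s (C_mat 1)"
    by (simp add: vec_eq_iff forall_3 star_def transpose_def)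
  moreover have "same_curve (C_curve s 1) (herm_form s (C_mat 1))"
    unfolding C_curve_eq same_curve_herm_form by (intro exI[of _ 1]) simp
  ultimately show ?thesis
    unfolding hermitian_def using invertible_C_mat[of 1] by auto
qed

section \<open>Counting the equivalence classes\<close>


lemma Nm_eq: "Nm s \<omega> = \<omega> * (\<omega>::'a) ^ s"
  by (simp add: Nm_def)

definition class_of :: "'a \<Rightarrow> 'a ternary set" where
  "class_of \<omega> = {G. proj_equiv (C_curve s \<omega>) G}"

lemma class_of_eq_iff:
  assumes "\<omega> \<noteq> 0" "\<omega>' \<noteq> 0"
  shows "class_of \<omega> = class_of \<omega>' \<longleftrightarrow> \<omega>' = \<omega> \<or> \<omega>' = inverse (\<omega> ^ s)"
proof -
  have herm: "hermitian_relative s (C_curve s \<omega>)" "hermitian_relative s (C_curve s \<omega>')"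
    using assms hermitian_relative_C_curve by blast+
  have "class_of \<omega> = class_of \<omega>' \<longleftrightarrow> proj_equiv (C_curve s \<omega>) (C_curve s \<omega>')"
  proof
    assume "class_of \<omega> = class_of \<omega>'"
    thus "proj_equiv (C_curve s \<omega>) (C_curve s \<omega>')"
      using proj_equiv_refl[OF herm(2)] unfolding class_of_def by blast
  next
    assume eq: "proj_equiv (C_curve s \<omega>) (C_curve s \<omega>')"
    have "proj_equiv (C_curve s \<omega>) G \<longleftrightarrow> proj_equiv (C_curve s \<omega>') G" for G
      using proj_equiv_trans[OF herm(1) eq] proj_equiv_trans[OF herm(2) proj_equiv_sym[OF herm(1) eq]]
      by blast
    thus "class_of \<omega> = class_of \<omega>'" by (simp add: class_of_def)
  qed
  thus ?thesis unfolding C_curve_equiv_iff[OF assms] .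
qed

text \<open>
  A form equivalent to a Hermitian relative is again one, so the symmetry and transitivity of projective equivalence
  among Hermitian relatives are all that its classes of members of \<open>S\<close> involve. Each class is then that of a normal form.
\<close>

lemma num_up_to_proj_equiv_eq:
  fixes S :: "'a ternary set"
  assumes "\<And>F. F \<in> S \<Longrightarrow> hermitian_relative s F"
    and "\<And>\<omega>. \<omega> \<in> Z \<Longrightarrow> \<omega> \<noteq> 0 \<and> C_curve s \<omega> \<in> S"
    and "\<And>F. F \<in> S \<Longrightarrow> \<exists>\<omega>\<in>Z. proj_equiv F (C_curve s \<omega>)"
  shows "num_up_to_proj_equiv S = card (class_of ` Z)"
proof -
  let ?R = "{(F :: 'a ternary, G). proj_equiv F G}"
  have eq: "?R `` {F} = class_of \<omega>" if F: "hermitian_relative s F" "proj_equiv F (C_curve s \<omega>)" for F \<omega>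
  proof -
    have "hermitian_relative s (C_curve s \<omega>)" "proj_equiv (C_curve s \<omega>) F"
      using hermitian_relative_proj_equiv[OF F] proj_equiv_sym[OF F] by blast+
    hence "proj_equiv F G \<longleftrightarrow> proj_equiv (C_curve s \<omega>) G" for G
      using F proj_equiv_trans by blast
    thus ?thesis by (simp add: class_of_def set_eq_iff)
  qed
  have "S // ?R = class_of ` Z"
  proof (intro set_eqI iffI)
    fix X assume "X \<in> S // ?R"
    then obtain F where F: "F \<in> S" "X = ?R `` {F}" by (rule quotientE)
    thus "X \<in> class_of ` Z" using assms(1,3)[OF F(1)] eq by blast
  next
    fix X assume "X \<in> class_of ` Z"
    then obtain \<omega> where \<omega>: "\<omega> \<in> Z" "X = class_of \<omega>" by blast
    have "X = ?R `` {C_curve s \<omega>}" unfolding \<omega>(2) class_of_def by blast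
    thus "X \<in> S // ?R" using assms(2)[OF \<omega>(1)] quotientI by metis
  qed
  thus ?thesis by (simp add: num_up_to_proj_equiv_def)
qed

lemma card_kernel_Nm: "card {\<omega>::'a. Nm s \<omega> = 1} = s + 1"
  using card_Nm_fibre[of 1] by (simp add: Nm_def)

lemma inverse_power_s_norm_1: "\<omega> * \<omega> ^ s = (1::'a) \<Longrightarrow> inverse (\<omega> ^ s) = \<omega>"
  by (rule inverse_unique) (simp add: mult.commute)

lemma C_curve_cases:
  assumes "\<omega> \<noteq> (0::'a)"
  obtains "\<omega> = 1" "card (rational_points (C_curve s \<omega>)) = s ^ 3 + 1"
      "card (rational_inflexions s (C_curve s \<omega>)) \<ge> s ^ 3 + 1"
    | "\<omega> \<noteq> 1" "\<omega> * \<omega> ^ s = 1" "card (rational_points (C_curve s \<omega>)) = s + 1"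
      "card (rational_inflexions s (C_curve s \<omega>)) \<ge> s + 1"
    | "\<omega> * \<omega> ^ s \<noteq> 1" "card (rational_points (C_curve s \<omega>)) = s ^ 2 + 1"
      "card (rational_inflexions s (C_curve s \<omega>)) = 2"
proof -
  have "card (rational_points (C_curve s \<omega>)) \<le> card (rational_inflexions s (C_curve s \<omega>))"
    if "\<omega> * \<omega> ^ s = 1"
  proof (rule card_mono)
    show "rational_points (C_curve s \<omega>) \<subseteq> rational_inflexions s (C_curve s \<omega>)"
      using rational_points_subset_inflexions_1 rational_points_subset_inflexions_norm_1[OF that]
      by blast
  qed simp
  thus ?thesis
    using that card_rational_points_C_curve_1 card_rational_points_C_curve_norm_1
      card_rational_points_C_curve_other card_rational_inflexions_C_curve[OF assms]
    by (cases "\<omega> = 1"; cases "\<omega> * \<omega> ^ s = 1") auto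
qed

lemma rational_inflexions_subset_points:
  "rational_inflexions s F \<subseteq> rational_points F"
  unfolding rational_inflexions_def rational_points_def by blast

lemma powers_distinct: "s + 1 \<noteq> s ^ 3 + 1" "s + 1 \<noteq> s ^ 2 + 1" "s ^ 2 + 1 < s ^ 3 + 1"
  "s ^ 3 + 1 > s + 1" "s ^ 3 + 1 > 2"
proof -
  have "s < s ^ 2" using power_strict_increasing[of 1 2 s] s_ge_2 by simp
  moreover have "s ^ 2 < s ^ 3" using power_strict_increasing[of 2 3 s] s_ge_2 by simp
  ultimately show "s + 1 \<noteq> s ^ 3 + 1" "s + 1 \<noteq> s ^ 2 + 1" "s ^ 2 + 1 < s ^ 3 + 1"
      "s ^ 3 + 1 > s + 1" "s ^ 3 + 1 > 2"
    using s_ge_2 by linarith+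
qed

lemma maximal_inflexions_equiv_C_curve_1:
  assumes "hermitian_relative s F" "card (rational_inflexions s (F :: 'a ternary)) = s ^ 3 + 1"
  shows "proj_equiv F (C_curve s 1)"
proof -
  obtain \<omega> where \<omega>: "\<omega> \<noteq> 0" "proj_equiv F (C_curve s \<omega>)"
    using two_inflexions_equiv_C_curve[OF assms(1)] assms(2) powers_distinct by auto
  have c: "card (rational_inflexions s (C_curve s \<omega>)) = s ^ 3 + 1"
    using proj_equiv_card(2)[OF assms(1) \<omega>(2)] assms(2) by simp
  have "card (rational_inflexions s (C_curve s \<omega>)) \<le> card (rational_points (C_curve s \<omega>))"
    by (intro card_mono rational_inflexions_subset_points) simp
  hence "card (rational_points (C_curve s \<omega>)) \<ge> s ^ 3 + 1" using c by simp
  note bound = this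
  have "\<omega> = 1"
    by (rule C_curve_cases[OF \<omega>(1)]) (use c bound powers_distinct in linarith)+
  thus ?thesis using \<omega>(2) by simp
qed

text \<open>
  The number of points singles out the \<open>\<omega> \<noteq> 1\<close> of norm \<open>1\<close>. For them \<open>\<omega>\<^bsup>-s\<^esup> = \<omega>\<close>, so different \<open>\<omega>\<close> give
  inequivalent curves, and the kernel of the norm has \<open>s + 1\<close> elements.
\<close>

lemma num_all_points_inflexions:
  "num_up_to_proj_equiv {F :: 'a ternary. hermitian_relative s F \<and>
     card (rational_points F) = s + 1 \<and> rational_points F \<subseteq> rational_inflexions s F} = s"
  (is "num_up_to_proj_equiv ?S = s")
proof -
  let ?Z = "{\<omega>::'a. Nm s \<omega> = 1} - {1}"
  have "num_up_to_proj_equiv ?S = card (class_of ` ?Z)"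
  proof (rule num_up_to_proj_equiv_eq)
    fix \<omega> assume \<omega>: "\<omega> \<in> ?Z"
    hence n: "\<omega> * \<omega> ^ s = 1" "\<omega> \<noteq> 1" by (simp_all add: Nm_eq)
    hence "\<omega> \<noteq> 0" by auto
    thus "\<omega> \<noteq> 0 \<and> C_curve s \<omega> \<in> ?S"
      using n hermitian_relative_C_curve card_rational_points_C_curve_norm_1
        rational_points_subset_inflexions_norm_1 by simp
  next
    fix F assume "F \<in> ?S"
    hence F: "hermitian_relative s F" "card (rational_points F) = s + 1"
      "rational_points F \<subseteq> rational_inflexions s F" by simp_all
    have "card (rational_inflexions s F) \<ge> 2"
      using card_mono[OF _ F(3)] F(2) s_ge_2 by simp
    from two_inflexions_equiv_C_curve[OF F(1) this]
    obtain \<omega> where \<omega>: "\<omega> \<noteq> 0" "proj_equiv F (C_curve s \<omega>)" by blast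
    have c: "card (rational_points (C_curve s \<omega>)) = s + 1"
      using proj_equiv_card(1)[OF F(1) \<omega>(2)] F(2) by simp
    have "\<omega> \<in> ?Z"
      by (rule C_curve_cases[OF \<omega>(1)]) (use c powers_distinct in \<open>simp_all add: Nm_eq\<close>)
    thus "\<exists>\<omega>\<in>?Z. proj_equiv F (C_curve s \<omega>)" using \<omega>(2) by blast
  qed simp
  also have "\<dots> = card ?Z"
  proof (rule card_image, rule inj_onI)
    fix \<omega> \<omega>' assume *: "\<omega> \<in> ?Z" "\<omega>' \<in> ?Z" "class_of \<omega> = class_of \<omega>'"
    hence n: "\<omega> * \<omega> ^ s = 1" "\<omega>' * \<omega>' ^ s = 1" by (simp_all add: Nm_eq)
    hence "\<omega> \<noteq> 0" "\<omega>' \<noteq> 0" by auto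
    thus "\<omega> = \<omega>'" using *(3) class_of_eq_iff inverse_power_s_norm_1[OF n(1)] by simp
  qed
  also have "\<dots> = s" using card_kernel_Nm by (simp add: Nm_def)
  finally show ?thesis .
qed

text \<open>
  On the \<open>s\<^sup>2 - 1 - (s + 1) = (s + 1)(s - 2)\<close> units not of norm \<open>1\<close>, the involution \<open>\<omega> \<mapsto> \<omega>\<^bsup>-s\<^esup>\<close> has no fixed
  point, so each class consists of two of them.
\<close>

lemma num_two_inflexions:
  "2 * num_up_to_proj_equiv {F :: 'a ternary. hermitian_relative s F \<and>
     card (rational_inflexions s F) = 2} = (s + 1) * (s - 2)"
  (is "2 * num_up_to_proj_equiv ?S = _")
proof -
  let ?Z = "- (insert (0::'a) {\<omega>. Nm s \<omega> = 1})"
  have Z: "\<omega> \<in> ?Z \<longleftrightarrow> \<omega> \<noteq> 0 \<and> \<omega> * \<omega> ^ s \<noteq> 1" for \<omega> by (auto simp: Nm_eq)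
  have num: "num_up_to_proj_equiv ?S = card (class_of ` ?Z)"
  proof (rule num_up_to_proj_equiv_eq)
    fix \<omega> assume "\<omega> \<in> ?Z"
    thus "\<omega> \<noteq> 0 \<and> C_curve s \<omega> \<in> ?S"
      using Z hermitian_relative_C_curve card_rational_inflexions_C_curve by simp
  next
    fix F assume "F \<in> ?S"
    hence F: "hermitian_relative s F" "card (rational_inflexions s F) = 2" by simp_all
    obtain \<omega> where \<omega>: "\<omega> \<noteq> 0" "proj_equiv F (C_curve s \<omega>)"
      using two_inflexions_equiv_C_curve[OF F(1)] F(2) by auto
    have c: "card (rational_inflexions s (C_curve s \<omega>)) = 2"
      using proj_equiv_card(2)[OF F(1) \<omega>(2)] F(2) by simp
    have "\<omega> * \<omega> ^ s \<noteq> 1"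
      by (rule C_curve_cases[OF \<omega>(1)]) (use c powers_distinct s_ge_2 in simp_all)
    thus "\<exists>\<omega>\<in>?Z. proj_equiv F (C_curve s \<omega>)" using \<omega> Z by blast
  qed simp
  have "card {\<omega> \<in> ?Z. class_of \<omega> = X} = 2" if "X \<in> class_of ` ?Z" for X
  proof -
    obtain \<alpha> where \<alpha>: "\<alpha> \<in> ?Z" "X = class_of \<alpha>" using \<open>X \<in> class_of ` ?Z\<close> by blast
    have a: "\<alpha> \<noteq> 0" "\<alpha> * \<alpha> ^ s \<noteq> 1" using \<alpha>(1) Z by blast+
    let ?\<beta> = "inverse (\<alpha> ^ s)"
    have norm: "?\<beta> * ?\<beta> ^ s = inverse (\<alpha> * \<alpha> ^ s)" using a(1) by (simp add: power_inverse)
    hence b: "?\<beta> \<noteq> 0" "?\<beta> * ?\<beta> ^ s \<noteq> 1" using a(1) by simp (use a(2) norm in \<open>metis inverse_eq_1_iff\<close>)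
    have "?\<beta> \<noteq> \<alpha>" using a by (metis power_s_eq_0 right_inverse mult.commute)
    have "{\<omega> \<in> ?Z. class_of \<omega> = X} = {\<alpha>, ?\<beta>}"
    proof (intro set_eqI iffI)
      fix \<omega> assume "\<omega> \<in> {\<omega> \<in> ?Z. class_of \<omega> = X}"
      hence "\<omega> \<noteq> 0" "class_of \<alpha> = class_of \<omega>" using \<alpha>(2) by auto
      thus "\<omega> \<in> {\<alpha>, ?\<beta>}" using class_of_eq_iff[OF a(1)] by blast
    next
      fix \<omega> assume "\<omega> \<in> {\<alpha>, ?\<beta>}"
      hence \<omega>: "\<omega> = \<alpha> \<or> \<omega> = ?\<beta>" by blast
      hence nz: "\<omega> \<noteq> 0" "\<omega> * \<omega> ^ s \<noteq> 1" using a b by auto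
      have "class_of \<omega> = X"
        using class_of_eq_iff[OF a(1) nz(1)] \<omega> unfolding \<alpha>(2) by metis
      thus "\<omega> \<in> {\<omega> \<in> ?Z. class_of \<omega> = X}" using nz Z by blast
    qed
    thus ?thesis using \<open>?\<beta> \<noteq> \<alpha>\<close> by simp
  qed
  hence "card ?Z = 2 * card (class_of ` ?Z)"
    using sum.image_gen[of ?Z "\<lambda>_. 1 :: nat" class_of] by simp
  moreover have "card ?Z = (s + 1) * (s - 2)"
  proof -
    have "card (insert (0::'a) {\<omega>. Nm s \<omega> = 1}) = s + 2"
      using card_kernel_Nm by (simp add: Nm_def)
    hence "card ?Z = s ^ 2 - (s + 2)"
      by (simp add: Compl_eq_Diff_UNIV card_Diff_subset card_field)
    also have "s ^ 2 = (s + 1) * (s - 2) + (s + 2)"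
    proof -
      obtain t where "s = t + 2" using s_ge_2 by (metis add.commute le_iff_add)
      thus ?thesis by (simp add: power2_eq_square algebra_simps)
    qed
    finally show ?thesis by simp
  qed
  ultimately show ?thesis using num by simp
qed

text \<open>
  \<open>D\<^sub>\<eta>\<close> is equivalent to \<open>C\<^sub>\<omega>\<close> with \<open>\<omega> = \<eta>\<^bsup>s - 1\<^esup>\<close> of norm \<open>1\<close>, and \<open>\<eta>\<^bsup>s - 1\<^esup>\<close> determines \<open>\<eta>\<close> up to a factor
  in the fixed field.
\<close>

lemma D_curve_equiv_iff:
  assumes "\<eta> \<noteq> 0" "\<eta>' \<noteq> (0::'a)"
  shows "proj_equiv (D_curve s \<eta>) (D_curve s \<eta>') \<longleftrightarrow> (\<eta> * inverse \<eta>') ^ s = \<eta> * inverse \<eta>'"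
proof -
  have n: "\<zeta> ^ (s - 1) \<noteq> 0" "\<zeta> ^ (s - 1) * (\<zeta> ^ (s - 1)) ^ s = 1" if "\<zeta> \<noteq> 0" for \<zeta> :: 'a
    using that unit_power_Nm[OF that] by simp_all
  note D = D_curve_equiv_C_curve[OF assms(1)] D_curve_equiv_C_curve[OF assms(2)]
  note herm = hermitian_relative_D_curve[OF assms(1)] hermitian_relative_D_curve[OF assms(2)]
    hermitian_relative_C_curve[OF n(1)[OF assms(1)]] hermitian_relative_C_curve[OF n(1)[OF assms(2)]]
  note D' = proj_equiv_sym[OF herm(1) D(1)] proj_equiv_sym[OF herm(2) D(2)]
  have "proj_equiv (D_curve s \<eta>) (D_curve s \<eta>') \<longleftrightarrow>
      proj_equiv (C_curve s (\<eta> ^ (s - 1))) (C_curve s (\<eta>' ^ (s - 1)))"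
  proof
    assume "proj_equiv (D_curve s \<eta>) (D_curve s \<eta>')"
    from proj_equiv_trans[OF herm(1) this D(2)]
    show "proj_equiv (C_curve s (\<eta> ^ (s - 1))) (C_curve s (\<eta>' ^ (s - 1)))"
      by (rule proj_equiv_trans[OF herm(3) D'(1)])
  next
    assume "proj_equiv (C_curve s (\<eta> ^ (s - 1))) (C_curve s (\<eta>' ^ (s - 1)))"
    from proj_equiv_trans[OF herm(3) this D'(2)]
    show "proj_equiv (D_curve s \<eta>) (D_curve s \<eta>')"
      by (rule proj_equiv_trans[OF herm(1) D(1)])
  qed
  also have "\<dots> \<longleftrightarrow> \<eta>' ^ (s - 1) = \<eta> ^ (s - 1)"
    using C_curve_equiv_iff[OF n(1) n(1)] inverse_power_s_norm_1[OF n(2)] assms by simp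
  also have "\<dots> \<longleftrightarrow> (\<eta> * inverse \<eta>') ^ s = \<eta> * inverse \<eta>'"
    using assms by (auto simp: power_s_eq_mult power_mult_distrib power_inverse field_simps)
  finally show ?thesis .
qed

lemma power_s_eq_self_iff:
  assumes "\<eta> \<noteq> (0::'a)"
  shows "\<eta> ^ s = \<eta> \<longleftrightarrow> \<eta> ^ (s - 1) = 1"
  using assms by (simp add: power_s_eq_mult)

text \<open>
  Hilbert's Theorem 90 provides \<open>\<eta>\<close> with \<open>\<eta>\<^bsup>s - 1\<^esup> = \<omega>\<close>.
\<close>

lemma C_curve_norm_1_equiv_D_curve:
  assumes "Nm s \<omega> = 1" "\<omega> \<noteq> (1::'a)"
  shows "\<exists>\<eta>. \<eta> \<noteq> 0 \<and> \<eta> ^ s \<noteq> \<eta> \<and> proj_equiv (C_curve s \<omega>) (D_curve s \<eta>)"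
proof -
  have "card {x. x ^ (s - 1) = \<omega>} \<noteq> 0"
    using card_Hilbert90_fibre[of \<omega>] assms(1) s_ge_2 by (simp add: Nm_def)
  then obtain \<eta> where \<eta>: "\<eta> ^ (s - 1) = \<omega>" by (auto simp: card_eq_0_iff)
  moreover have "\<omega> \<noteq> 0" using assms(1) by (auto simp: Nm_def)
  ultimately have "\<eta> \<noteq> 0" using s_ge_2 by (auto simp: power_0_left)
  moreover have "proj_equiv (C_curve s \<omega>) (D_curve s \<eta>)"
    using D_curve_equiv_C_curve[OF \<open>\<eta> \<noteq> 0\<close>] hermitian_relative_D_curve[OF \<open>\<eta> \<noteq> 0\<close>] proj_equiv_sym
    unfolding \<eta> by blast
  ultimately show ?thesis using power_s_eq_self_iff \<eta> assms(2) by blast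
qed

lemma D_curve_equiv_C_curve_norm_1:
  assumes "\<eta> \<noteq> 0" "\<eta> ^ s \<noteq> (\<eta>::'a)"
  shows "\<exists>\<omega>. \<omega> \<noteq> 0 \<and> Nm s \<omega> = 1 \<and> \<omega> \<noteq> 1 \<and> proj_equiv (D_curve s \<eta>) (C_curve s \<omega>)"
  using assms D_curve_equiv_C_curve power_s_eq_self_iff unit_power_Nm[OF assms(1)]
  by (intro exI[of _ "\<eta> ^ (s - 1)"]) (simp add: Nm_def)

end

theorem theorem3p1:
  fixes p k s :: nat and Ks :: "'a::{field,finite} set"
  assumes "prime p" and "k \<ge> 1" and "s = p ^ k"
    and "CARD('a) = s ^ 2"
    and "Ks = subfield_of_order s - {0}"
  shows
    "(\<forall>F :: 'a ternary. hermitian_relative s F \<and> card (rational_inflexions s F) \<ge> 2 \<longrightarrow>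
        (\<exists>\<omega>. \<omega> \<noteq> 0 \<and> proj_equiv F (C_curve s \<omega>))) \<and>
     (\<forall>\<omega> :: 'a. \<omega> \<noteq> 0 \<longrightarrow> card (rational_inflexions s (C_curve s \<omega>)) \<ge> 2) \<and>

     (card (rational_points (C_curve s (1 :: 'a))) = s ^ 3 + 1 \<and>
      rational_points (C_curve s (1 :: 'a)) \<subseteq> rational_inflexions s (C_curve s 1) \<and>
      hermitian s (C_curve s (1 :: 'a)) \<and>
      (\<forall>F G :: 'a ternary.
         hermitian_relative s F \<and> card (rational_inflexions s F) = s ^ 3 + 1 \<and>
         hermitian_relative s G \<and> card (rational_inflexions s G) = s ^ 3 + 1 \<longrightarrow>
         proj_equiv F G)) \<and>

     ((\<forall>\<omega> :: 'a. \<omega> \<noteq> 0 \<and> Nm s \<omega> = 1 \<and> \<omega> \<noteq> 1 \<longrightarrow>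
         card (rational_points (C_curve s \<omega>)) = s + 1 \<and>
         rational_points (C_curve s \<omega>) \<subseteq> rational_inflexions s (C_curve s \<omega>) \<and>
         (\<exists>\<eta>. \<eta> \<noteq> 0 \<and> \<eta> \<notin> Ks \<and> proj_equiv (C_curve s \<omega>) (D_curve s \<eta>))) \<and>
      (\<forall>\<eta> :: 'a. \<eta> \<noteq> 0 \<and> \<eta> \<notin> Ks \<longrightarrow>
         (\<exists>\<omega>. \<omega> \<noteq> 0 \<and> Nm s \<omega> = 1 \<and> \<omega> \<noteq> 1 \<and> proj_equiv (D_curve s \<eta>) (C_curve s \<omega>))) \<and>
      (\<forall>\<eta> \<eta>' :: 'a. \<eta> \<noteq> 0 \<and> \<eta> \<notin> Ks \<and> \<eta>' \<noteq> 0 \<and> \<eta>' \<notin> Ks \<longrightarrow>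
         (proj_equiv (D_curve s \<eta>) (D_curve s \<eta>') \<longleftrightarrow> \<eta> * inverse \<eta>' \<in> Ks)) \<and>
      num_up_to_proj_equiv {F :: 'a ternary. hermitian_relative s F \<and>
         card (rational_points F) = s + 1 \<and> rational_points F \<subseteq> rational_inflexions s F} = s) \<and>

     ((\<forall>\<omega> :: 'a. \<omega> \<noteq> 0 \<and> Nm s \<omega> \<noteq> 1 \<longrightarrow>
         card (rational_points (C_curve s \<omega>)) = s\<^sup>2 + 1 \<and>
         card (rational_inflexions s (C_curve s \<omega>)) = 2) \<and>
      (\<forall>\<omega> \<omega>' :: 'a. \<omega> \<noteq> 0 \<and> Nm s \<omega> \<noteq> 1 \<and> \<omega>' \<noteq> 0 \<and> Nm s \<omega>' \<noteq> 1 \<longrightarrow>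
         (proj_equiv (C_curve s \<omega>) (C_curve s \<omega>') \<longleftrightarrow> \<omega>' = \<omega> \<or> \<omega>' = inverse (\<omega> ^ s))) \<and>
      real (num_up_to_proj_equiv {F :: 'a ternary. hermitian_relative s F \<and>
         card (rational_inflexions s F) = 2}) = 1 / 2 * (real s + 1) * (real s - 2))"
proof -
  interpret square_field p k s "TYPE('a)"
    using assms by unfold_locales
  have Ks: "x \<in> Ks \<longleftrightarrow> x ^ s = x \<and> x \<noteq> 0" for x
    unfolding assms(5) subfield_eq_fixed by simp
  have nK: "x \<notin> Ks \<longleftrightarrow> x ^ s \<noteq> x" if "x \<noteq> 0" for x
    using that Ks by blast
  show ?thesis
  proof (intro conjI allI impI; (elim conjE)?)
    fix F :: "'a ternary"
    assume "hermitian_relative s F" "card (rational_inflexions s F) \<ge> 2"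
    thus "\<exists>\<omega>. \<omega> \<noteq> 0 \<and> proj_equiv F (C_curve s \<omega>)" by (rule two_inflexions_equiv_C_curve)
  next
    fix F G :: "'a ternary"
    assume F: "hermitian_relative s F" "card (rational_inflexions s F) = s ^ 3 + 1"
      and G: "hermitian_relative s G" "card (rational_inflexions s G) = s ^ 3 + 1"
    have "proj_equiv (C_curve s 1) G"
      using G maximal_inflexions_equiv_C_curve_1 proj_equiv_sym by blast
    thus "proj_equiv F G"
      using F maximal_inflexions_equiv_C_curve_1 proj_equiv_trans by blast
  next
    fix \<omega> :: 'a assume \<omega>: "Nm s \<omega> = 1" "\<omega> \<noteq> 1"
    hence norm: "\<omega> * \<omega> ^ s = 1" by (simp add: Nm_eq)
    show "card (rational_points (C_curve s \<omega>)) = s + 1"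
      by (rule card_rational_points_C_curve_norm_1[OF norm \<omega>(2)])
    show "rational_points (C_curve s \<omega>) \<subseteq> rational_inflexions s (C_curve s \<omega>)"
      by (rule rational_points_subset_inflexions_norm_1[OF norm \<omega>(2)])
    show "\<exists>\<eta>. \<eta> \<noteq> 0 \<and> \<eta> \<notin> Ks \<and> proj_equiv (C_curve s \<omega>) (D_curve s \<eta>)"
      using C_curve_norm_1_equiv_D_curve[OF \<omega>] Ks by blast
  next
    fix \<eta> :: 'a assume "\<eta> \<noteq> 0" "\<eta> \<notin> Ks"
    thus "\<exists>\<omega>. \<omega> \<noteq> 0 \<and> Nm s \<omega> = 1 \<and> \<omega> \<noteq> 1 \<and> proj_equiv (D_curve s \<eta>) (C_curve s \<omega>)"
      using D_curve_equiv_C_curve_norm_1 nK by blast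
  next
    fix \<eta> \<eta>' :: 'a assume "\<eta> \<noteq> 0" "\<eta>' \<noteq> 0"
    thus "proj_equiv (D_curve s \<eta>) (D_curve s \<eta>') \<longleftrightarrow> \<eta> * inverse \<eta>' \<in> Ks"
      unfolding Ks using D_curve_equiv_iff by simp
  next
    fix \<omega> :: 'a assume "\<omega> \<noteq> 0" "Nm s \<omega> \<noteq> 1"
    thus "card (rational_points (C_curve s \<omega>)) = s\<^sup>2 + 1"
      "card (rational_inflexions s (C_curve s \<omega>)) = 2"
      using card_rational_points_C_curve_other card_rational_inflexions_C_curve
      by (simp_all add: Nm_eq)
  next
    fix \<omega> \<omega>' :: 'a assume "\<omega> \<noteq> 0" "\<omega>' \<noteq> 0"
    thus "proj_equiv (C_curve s \<omega>) (C_curve s \<omega>') \<longleftrightarrow> \<omega>' = \<omega> \<or> \<omega>' = inverse (\<omega> ^ s)"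
      by (rule C_curve_equiv_iff)
  next
    let ?n = "num_up_to_proj_equiv {F :: 'a ternary. hermitian_relative s F \<and>
         card (rational_inflexions s F) = 2}"
    have "real (2 * ?n) = real ((s + 1) * (s - 2))" by (simp only: num_two_inflexions)
    thus "real ?n = 1 / 2 * (real s + 1) * (real s - 2)"
      using s_ge_2 by (simp add: of_nat_diff field_simps)
  next
    fix \<omega> :: 'a assume "\<omega> \<noteq> 0"
    thus "card (rational_inflexions s (C_curve s \<omega>)) \<ge> 2"
      by (rule two_le_card_rational_inflexions_C_curve)
  qed (fact card_rational_points_C_curve_1 rational_points_subset_inflexions_1
      hermitian_C_curve_1 num_all_points_inflexions)+
qed

end
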